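(* Let $\mathbb K$ be a commutative unital ring in which $2$ is invertible, let $G$ be a centrally $\mathbb Z/2\mathbb Z$-graded group whose grading element $Z$ is non-trivial ($Z\neq e$), and let $\mathbb A=\mathbb K[G]$ be its group algebra. (1) $\mathbb K[G]$ is a direct sum of ideals, $\mathbb K[G]=\mathbb K[G]^+\oplus\mathbb K[G]^-$, and both $\mathbb K[G]^+$ and $\mathbb K[G]^-$ are isomorphic as $\mathbb K$-modules. The projection $\pi:G\to G^0=G/\{e,Z\}$ induces an algebra morphism $\pi_*:\mathbb K[G]\to\mathbb K[G^0]$ having kernel $\mathbb K[G]^-$ and image isomorphic to $\mathbb K[G]^+$, so $\mathbb K[G]^+\cong\mathbb K[G^0]$ as algebras. (2) With respect to $\alpha_*$, the group algebra $\mathbb K[G]$ and the ideals $\mathbb K[G]^\pm$ are super-algebras (i.e. $\mathbb Z/2\mathbb Z$-graded algebras with even and odd parts the $+1$- and $-1$-eigenspaces of $\alpha_*$). The disjoint union $G=G_0\sqcup G_1$ induces a decomposition $\mathbb K[G]=\mathbb K[G_0]\oplus\mathbb K[G_1]$ such that $$\mathbb K[G_0]\subset\mathbb A_0,\qquad\mathbb A_1\subset\mathbb K[G_1].$$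
   Context: A centrally $\mathbb Z/2\mathbb Z$-graded group is a group $G$ with a morphism $d:G\to\mathbb Z/2\mathbb Z$ and a central element $Z$ (the grading element) with $Z^2=e$ and $d(Z)=0$. $G_k=d^{-1}(k)$ for $k\in\mathbb Z/2\mathbb Z$. $\mathbb K[M]$ is the free $\mathbb K$-module with basis $(\delta_m)_{m\in M}$; for a group $G$ it is an algebra with $\delta_x*\delta_y=\delta_{xy}$. The maps $g\mapsto Zg$ and $\alpha:g\mapsto Z^{d(g)}g$ of $G$ induce $\mathbb K$-linear maps $Z_*:\delta_g\mapsto\delta_{Zg}$ and $\alpha_*:\delta_g\mapsto\delta_{\alpha(g)}$ of $\mathbb A=\mathbb K[G]$. Put $\mathbb K[G]^\pm=\mathbb A^\pm=\{f\in\mathbb A\mid Z_*f=\pm f\}$ and $\mathbb A_k=\{f\in\mathbb A\mid\alpha_*f=(-1)^kf\}$, $k\in\{0,1\}$. *)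

theory Defs
  imports "HOL-Algebra.Algebra"
begin

section \<open>Algebras over a commutative ring\<close>

text \<open>The locale \<^locale>\<open>algebra\<close> of the library is restricted to commutative algebras; group
  algebras require the version for arbitrary unital rings.\<close>

locale assoc_algebra = module + ring M +
  assumes smult_mult_left:
      "\<lbrakk>a \<in> carrier R; x \<in> carrier M; y \<in> carrier M\<rbrakk> \<Longrightarrow>
        (a \<odot>\<^bsub>M\<^esub> x) \<otimes>\<^bsub>M\<^esub> y = a \<odot>\<^bsub>M\<^esub> (x \<otimes>\<^bsub>M\<^esub> y)"
    and smult_mult_right:
      "\<lbrakk>a \<in> carrier R; x \<in> carrier M; y \<in> carrier M\<rbrakk> \<Longrightarrow>
        x \<otimes>\<^bsub>M\<^esub> (a \<odot>\<^bsub>M\<^esub> y) = a \<odot>\<^bsub>M\<^esub> (x \<otimes>\<^bsub>M\<^esub> y)"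

definition module_hom ::
    "('k, 'm) ring_scheme \<Rightarrow> ('k, 'a, 'p) module_scheme \<Rightarrow> ('k, 'b, 'q) module_scheme \<Rightarrow> ('a \<Rightarrow> 'b) \<Rightarrow> bool"
  where "module_hom K M N h \<longleftrightarrow>
    module K M \<and> module K N \<and> h \<in> carrier M \<rightarrow> carrier N \<and>
    (\<forall>x\<in>carrier M. \<forall>y\<in>carrier M. h (x \<oplus>\<^bsub>M\<^esub> y) = h x \<oplus>\<^bsub>N\<^esub> h y) \<and>
    (\<forall>c\<in>carrier K. \<forall>x\<in>carrier M. h (c \<odot>\<^bsub>M\<^esub> x) = c \<odot>\<^bsub>N\<^esub> h x)"

definition module_isomorphic ::
    "('k, 'm) ring_scheme \<Rightarrow> ('k, 'a, 'p) module_scheme \<Rightarrow> ('k, 'b, 'q) module_scheme \<Rightarrow> bool"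
  where "module_isomorphic K M N \<longleftrightarrow>
    (\<exists>h. module_hom K M N h \<and> bij_betw h (carrier M) (carrier N))"

definition algebra_hom ::
    "('k, 'm) ring_scheme \<Rightarrow> ('k, 'a, 'p) module_scheme \<Rightarrow> ('k, 'b, 'q) module_scheme \<Rightarrow> ('a \<Rightarrow> 'b) \<Rightarrow> bool"
  where "algebra_hom K A B h \<longleftrightarrow>
    assoc_algebra K A \<and> assoc_algebra K B \<and> module_hom K A B h \<and> h \<in> ring_hom A B"

definition algebra_isomorphic ::
    "('k, 'm) ring_scheme \<Rightarrow> ('k, 'a, 'p) module_scheme \<Rightarrow> ('k, 'b, 'q) module_scheme \<Rightarrow> bool"
  where "algebra_isomorphic K A B \<longleftrightarrow>
    (\<exists>h. algebra_hom K A B h \<and> bij_betw h (carrier A) (carrier B))"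

definition internal_direct_sum ::
    "('k, 'm) ring_scheme \<Rightarrow> ('k, 'a, 'p) module_scheme \<Rightarrow> 'a set \<Rightarrow> 'a set \<Rightarrow> bool"
  where "internal_direct_sum K M U V \<longleftrightarrow>
    module K M \<and> submodule U K M \<and> submodule V K M \<and>
    U <+>\<^bsub>M\<^esub> V = carrier M \<and> U \<inter> V = {\<zero>\<^bsub>M\<^esub>}"

text \<open>An ideal that is a direct summand of a unital algebra is itself a unital algebra, but its unit
  is not the unit of the ambient algebra (the unit of an ideal, if it exists, is unique).\<close>

definition ideal_algebra :: "('k, 'a, 'p) module_scheme \<Rightarrow> 'a set \<Rightarrow> ('k, 'a, 'p) module_scheme"
  where "ideal_algebra A I = A\<lparr>carrier := I,
    one := (THE u. u \<in> I \<and> (\<forall>x\<in>I. u \<otimes>\<^bsub>A\<^esub> x = x \<and> x \<otimes>\<^bsub>A\<^esub> u = x))\<rparr>"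

definition eigenspace ::
    "('k, 'a, 'p) module_scheme \<Rightarrow> ('a \<Rightarrow> 'a) \<Rightarrow> 'k \<Rightarrow> 'a set"
  where "eigenspace A T c = {f \<in> carrier A. T f = c \<odot>\<^bsub>A\<^esub> f}"

text \<open>A super-algebra is a \<open>\<int>/2\<int>\<close>-graded algebra; only the parts \<open>V 0\<close> (even) and \<open>V 1\<close> (odd)
  are relevant.\<close>

definition super_algebra ::
    "('k, 'm) ring_scheme \<Rightarrow> ('k, 'a, 'p) module_scheme \<Rightarrow> (nat \<Rightarrow> 'a set) \<Rightarrow> bool"
  where "super_algebra K A V \<longleftrightarrow>
    assoc_algebra K A \<and> internal_direct_sum K A (V 0) (V 1) \<and>
    (\<forall>i\<in>{0, 1}. \<forall>j\<in>{0, 1}. \<forall>x\<in>V i. \<forall>y\<in>V j. x \<otimes>\<^bsub>A\<^esub> y \<in> V ((i + j) mod 2))"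

definition super_algebra_wrt ::
    "('k, 'm) ring_scheme \<Rightarrow> ('k, 'a, 'p) module_scheme \<Rightarrow> ('a \<Rightarrow> 'a) \<Rightarrow> bool"
  where "super_algebra_wrt K A T \<longleftrightarrow>
    module_hom K A A T \<and>
    super_algebra K A (\<lambda>k. eigenspace A T ((\<ominus>\<^bsub>K\<^esub> \<one>\<^bsub>K\<^esub>) [^]\<^bsub>K\<^esub> k))"


section \<open>Free modules and group algebras\<close>

definition supp :: "('k, 'm) ring_scheme \<Rightarrow> ('a \<Rightarrow> 'k) \<Rightarrow> 'a set"
  where "supp K f = {x. f x \<noteq> \<zero>\<^bsub>K\<^esub>}"

definition delta :: "('k, 'm) ring_scheme \<Rightarrow> 'a \<Rightarrow> 'a \<Rightarrow> 'k"
  where "delta K m = (\<lambda>x. if x = m then \<one>\<^bsub>K\<^esub> else \<zero>\<^bsub>K\<^esub>)"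

text \<open>Elements are functions on the whole type that vanish outside \<open>M\<close>, so that the free module on a
  subset of \<open>M\<close> is literally a subset of the free module on \<open>M\<close>. The record type
  \<^typ>\<open>('k, 'a) module\<close> extends rings; the multiplicative fields are irrelevant for a module.\<close>

definition free_module :: "('k, 'm) ring_scheme \<Rightarrow> 'a set \<Rightarrow> ('k, 'a \<Rightarrow> 'k) module"
  where "free_module K M =
    \<lparr>carrier = {f. range f \<subseteq> carrier K \<and> finite (supp K f) \<and> supp K f \<subseteq> M},
     monoid.mult = undefined, one = undefined,
     ring.zero = (\<lambda>x. \<zero>\<^bsub>K\<^esub>),
     ring.add = (\<lambda>f h x. f x \<oplus>\<^bsub>K\<^esub> h x),
     smult = (\<lambda>c f x. c \<otimes>\<^bsub>K\<^esub> f x)\<rparr>"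

text \<open>The product is the bilinear extension of \<open>\<delta>\<^sub>x * \<delta>\<^sub>y = \<delta>\<^bsub>xy\<^esub>\<close>; see \<open>delta_mult\<close> below.\<close>

definition group_algebra ::
    "('k, 'm) ring_scheme \<Rightarrow> ('g, 'n) monoid_scheme \<Rightarrow> ('k, 'g \<Rightarrow> 'k) module"
  where "group_algebra K G = (free_module K (carrier G))
    \<lparr>monoid.mult := (\<lambda>f h z. \<Oplus>\<^bsub>K\<^esub>p\<in>{(x, y). x \<in> supp K f \<and> y \<in> supp K h \<and> x \<otimes>\<^bsub>G\<^esub> y = z}.
        f (fst p) \<otimes>\<^bsub>K\<^esub> h (snd p)),
     one := delta K \<one>\<^bsub>G\<^esub>\<rparr>"

text \<open>The linear map \<open>\<phi>\<^sub>*\<close> with \<open>\<phi>\<^sub>* \<delta>\<^sub>m = \<delta>\<^bsub>\<phi>(m)\<^esub>\<close>; see \<open>pushforward_delta\<close> below.\<close>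

definition pushforward ::
    "('k, 'm) ring_scheme \<Rightarrow> ('a \<Rightarrow> 'b) \<Rightarrow> ('a \<Rightarrow> 'k) \<Rightarrow> 'b \<Rightarrow> 'k"
  where "pushforward K \<phi> f = (\<lambda>n. \<Oplus>\<^bsub>K\<^esub>m\<in>{m \<in> supp K f. \<phi> m = n}. f m)"

lemma delta_mult:
  assumes "cring K"
  shows "delta K x \<otimes>\<^bsub>group_algebra K G\<^esub> delta K y = delta K (x \<otimes>\<^bsub>G\<^esub> y)"
proof -
  interpret cring K by fact
  show ?thesis
  proof (cases "\<one>\<^bsub>K\<^esub> = \<zero>\<^bsub>K\<^esub>")
    case True
    then show ?thesis
      by (auto simp: group_algebra_def delta_def supp_def fun_eq_iff)
  next
    case False
    have "(\<Oplus>\<^bsub>K\<^esub>p\<in>{(a, b). a \<in> supp K (delta K x) \<and> b \<in> supp K (delta K y) \<and> a \<otimes>\<^bsub>G\<^esub> b = z}.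
        delta K x (fst p) \<otimes>\<^bsub>K\<^esub> delta K y (snd p)) = delta K (x \<otimes>\<^bsub>G\<^esub> y) z" for z
    proof -
      have "{(a, b). a \<in> supp K (delta K x) \<and> b \<in> supp K (delta K y) \<and> a \<otimes>\<^bsub>G\<^esub> b = z} =
          (if z = x \<otimes>\<^bsub>G\<^esub> y then {(x, y)} else {})"
        using False by (auto simp: supp_def delta_def)
      then show ?thesis
        by (simp add: delta_def)
    qed
    then show ?thesis
      by (simp add: group_algebra_def fun_eq_iff)
  qed
qed

lemma pushforward_delta:
  assumes "cring K"
  shows "pushforward K \<phi> (delta K m) = delta K (\<phi> m)"
proof -
  interpret cring K by fact
  have "(\<Oplus>\<^bsub>K\<^esub>a\<in>{a \<in> supp K (delta K m). \<phi> a = n}. delta K m a) = delta K (\<phi> m) n" for n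
  proof (cases "\<one>\<^bsub>K\<^esub> = \<zero>\<^bsub>K\<^esub>")
    case True
    then show ?thesis
      by (auto simp: delta_def supp_def)
  next
    case False
    then have "{a \<in> supp K (delta K m). \<phi> a = n} = (if n = \<phi> m then {m} else {})"
      by (auto simp: supp_def delta_def)
    then show ?thesis
      by (simp add: delta_def)
  qed
  then show ?thesis
    by (simp add: pushforward_def fun_eq_iff)
qed


section \<open>Centrally graded groups\<close>

text \<open>The group \<open>\<int>/2\<int>\<close> is \<^term>\<open>integer_mod_group 2\<close>, with carrier \<open>{0, 1}\<close>.\<close>

locale centrally_graded_group = group G
  for G :: "('g, 'n) monoid_scheme" (structure) and d :: "'g \<Rightarrow> int" and Z :: 'g +
  assumes degree_hom: "d \<in> hom G (integer_mod_group 2)"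
    and grading_closed: "Z \<in> carrier G"
    and grading_central: "g \<in> carrier G \<Longrightarrow> Z \<otimes> g = g \<otimes> Z"
    and grading_square: "Z \<otimes> Z = \<one>"
    and grading_degree: "d Z = 0"

definition degree_part :: "('g, 'n) monoid_scheme \<Rightarrow> ('g \<Rightarrow> int) \<Rightarrow> nat \<Rightarrow> 'g set"
  where "degree_part G d k = {g \<in> carrier G. d g = int k}"

definition grading_aut :: "('g, 'n) monoid_scheme \<Rightarrow> ('g \<Rightarrow> int) \<Rightarrow> 'g \<Rightarrow> 'g \<Rightarrow> 'g"
  where "grading_aut G d Z = (\<lambda>g. (Z [^]\<^bsub>G\<^esub> d g) \<otimes>\<^bsub>G\<^esub> g)"

definition plus_part :: "('k, 'm) ring_scheme \<Rightarrow> ('g, 'n) monoid_scheme \<Rightarrow> 'g \<Rightarrow> ('g \<Rightarrow> 'k) set"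
  where "plus_part K G Z =
    {f \<in> carrier (group_algebra K G). pushforward K (\<lambda>g. Z \<otimes>\<^bsub>G\<^esub> g) f = f}"

definition minus_part :: "('k, 'm) ring_scheme \<Rightarrow> ('g, 'n) monoid_scheme \<Rightarrow> 'g \<Rightarrow> ('g \<Rightarrow> 'k) set"
  where "minus_part K G Z =
    {f \<in> carrier (group_algebra K G).
      pushforward K (\<lambda>g. Z \<otimes>\<^bsub>G\<^esub> g) f = \<ominus>\<^bsub>group_algebra K G\<^esub> f}"

definition alpha_part ::
    "('k, 'm) ring_scheme \<Rightarrow> ('g, 'n) monoid_scheme \<Rightarrow> ('g \<Rightarrow> int) \<Rightarrow> 'g \<Rightarrow> nat \<Rightarrow> ('g \<Rightarrow> 'k) set"
  where "alpha_part K G d Z k =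
    eigenspace (group_algebra K G) (pushforward K (grading_aut G d Z))
      ((\<ominus>\<^bsub>K\<^esub> \<one>\<^bsub>K\<^esub>) [^]\<^bsub>K\<^esub> k)"

lemma (in centrally_graded_group) grading_normal: "{\<one>, Z} \<lhd> G"
proof -
  have "inv Z = Z"
    using grading_closed grading_square by (simp add: inv_equality)
  then have "subgroup {\<one>, Z} G"
    using grading_closed grading_square by (intro subgroupI) auto
  then show ?thesis
    using grading_closed grading_central
    by (auto simp: normal_inv_iff m_assoc)
       (metis grading_central grading_closed inv_closed m_assoc r_inv r_one)
qed

end

theory Submission
  imports Defs
begin

text \<open>The map \<open>Z\<^sub>*\<close> is multiplication by the central element \<open>\<delta>\<^sub>Z\<close>, whose square is \<open>1\<close>. As \<open>2\<close> is
  invertible, the algebra splits into the eigenspaces of \<open>Z\<^sub>*\<close>, which are ideals with units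
  \<open>(1 \<plusminus> \<delta>\<^sub>Z) / 2\<close>. A fibre sum of \<open>\<pi>\<^sub>*\<close> is \<open>f(g) + f(Zg)\<close>, so the kernel of \<open>\<pi>\<^sub>*\<close> is the minus part, and
  the surjection \<open>\<pi>\<^sub>*\<close> restricts to an isomorphism on the complementary plus part. Any involutive
  automorphism grades an algebra by its eigenspaces; \<open>\<alpha>\<^sub>*\<close> is one, commutes with \<open>Z\<^sub>*\<close>, and is the
  identity on the span of \<open>G\<^sub>0\<close>.\<close>

section \<open>Free modules\<close>

text \<open>The product is a sum over supports, and supports shrink under cancellation. Products are
  therefore treated as pushforwards, so that identities between algebra elements reduce to
  identities between maps of the bases.

  Invertibility of 2 supplies the projectors (1 + T)/2 and (1 - T)/2 of an involution T, and forces
  a coefficient with f(g) = -f(g) to vanish. Non-triviality of Z means that Z moves every element of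
  G. Hence every coset has exactly two elements, which gives the two-term fibre sums as well as the
  sign function comparing the plus and minus parts. For Z = e the minus part would be zero while the
  plus part would be everything.

  On functions supported in degree 1, the map induced by \<alpha> is the one induced by Z. So the
  even part consists of the span of degree 0 and the invariants of Z in the span of degree 1, and
  the odd part is the minus part of the latter span. In general both inclusions between degree spans
  and eigenspaces are therefore strict.\<close>

context cring
begin

lemma free_module_iff:
  "f \<in> carrier (free_module R M) \<longleftrightarrow>
    (\<forall>x. f x \<in> carrier R) \<and> finite (supp R f) \<and> supp R f \<subseteq> M"
  by (auto simp: free_module_def)

lemma free_module_simps [simp]:
  "\<zero>\<^bsub>free_module R M\<^esub> = (\<lambda>x. \<zero>)"
  "f \<oplus>\<^bsub>free_module R M\<^esub> h = (\<lambda>x. f x \<oplus> h x)"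
  "c \<odot>\<^bsub>free_module R M\<^esub> f = (\<lambda>x. c \<otimes> f x)"
  by (simp_all add: free_module_def)

text \<open>A finite bound \<open>S\<close> for the support suffices, so the exact support, which
  depends on cancellation, never has to be computed.\<close>

lemma free_moduleI:
  assumes "\<And>x. f x \<in> carrier R" "finite S" "S \<subseteq> M" "\<And>x. x \<notin> S \<Longrightarrow> f x = \<zero>"
  shows "f \<in> carrier (free_module R M)"
proof -
  have "supp R f \<subseteq> S"
    using assms(4) by (auto simp: supp_def)
  then show ?thesis
    using assms(1-3) finite_subset by (auto simp: free_module_iff)
qed

lemma free_module_closed [simp]: "f \<in> carrier (free_module R M) \<Longrightarrow> f x \<in> carrier R"
  by (simp add: free_module_iff)

lemma free_module_outside: "f \<in> carrier (free_module R M) \<Longrightarrow> x \<notin> M \<Longrightarrow> f x = \<zero>"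
  by (auto simp: free_module_iff supp_def)

lemma free_module_mono: "M \<subseteq> N \<Longrightarrow> carrier (free_module R M) \<subseteq> carrier (free_module R N)"
  by (fastforce simp: free_module_iff)

lemma free_module_add:
  assumes "f \<in> carrier (free_module R M)" "h \<in> carrier (free_module R M)"
  shows "(\<lambda>x. f x \<oplus> h x) \<in> carrier (free_module R M)"
  using assms by (intro free_moduleI[where S = "supp R f \<union> supp R h"]) (auto simp: free_module_iff supp_def)

text \<open>The factor may vary with the point: a constant \<open>s\<close> gives scalar multiples,
  a sign function gives the map between the plus and minus parts.\<close>

lemma free_module_mult:
  assumes "f \<in> carrier (free_module R M)" "\<And>x. s x \<in> carrier R"
  shows "(\<lambda>x. s x \<otimes> f x) \<in> carrier (free_module R M)"
  using assms by (intro free_moduleI[where S = "supp R f"]) (auto simp: free_module_iff supp_def)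

lemma module_free_module: "module R (free_module R M)"
proof (intro moduleI abelian_groupI)
  fix f assume f: "f \<in> carrier (free_module R M)"
  then have "(\<lambda>x. \<ominus> \<one> \<otimes> f x) \<in> carrier (free_module R M)"
    by (intro free_module_mult) auto
  moreover have "(\<lambda>x. \<ominus> \<one> \<otimes> f x \<oplus> f x) = (\<lambda>x. \<zero>)"
    using f by (auto simp: l_minus l_neg)
  ultimately show "\<exists>h\<in>carrier (free_module R M). h \<oplus>\<^bsub>free_module R M\<^esub> f = \<zero>\<^bsub>free_module R M\<^esub>"
    by (intro bexI[where x = "\<lambda>x. \<ominus> \<one> \<otimes> f x"]) auto
qed (auto simp: is_cring free_module_add free_module_mult a_ac m_assoc l_distr r_distr
    intro!: free_moduleI[where S = "{}"])

lemma delta_in_free_module: "m \<in> M \<Longrightarrow> delta R m \<in> carrier (free_module R M)"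
  by (rule free_moduleI[where S = "{m}"]) (auto simp: delta_def)

section \<open>Linear maps induced by maps of the basis\<close>

text \<open>Padding with zeros makes it possible to sum several functions over one common finite
  set.\<close>

lemma pushforward_eq:
  assumes "f \<in> carrier (free_module R M)" "finite S" "supp R f \<subseteq> S"
  shows "pushforward R \<phi> f n = (\<Oplus>m\<in>{m \<in> S. \<phi> m = n}. f m)"
  unfolding pushforward_def
  by (rule add.finprod_mono_neutral_cong_left) (use assms in \<open>auto simp: supp_def\<close>)

lemma pushforward_closed:
  assumes f: "f \<in> carrier (free_module R M)" and "\<phi> \<in> M \<rightarrow> N"
  shows "pushforward R \<phi> f \<in> carrier (free_module R N)"
proof (rule free_moduleI[where S = "\<phi> ` supp R f"])
  show "pushforward R \<phi> f n = \<zero>" if "n \<notin> \<phi> ` supp R f" for n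
  proof -
    have "{m \<in> supp R f. \<phi> m = n} = {}"
      using that by auto
    then show ?thesis
      by (simp only: pushforward_def finsum_empty)
  qed
qed (use assms in \<open>auto simp: pushforward_def free_module_iff\<close>)

lemma pushforward_add:
  assumes f: "f \<in> carrier (free_module R M)" and h: "h \<in> carrier (free_module R M)"
  shows "pushforward R \<phi> (\<lambda>x. f x \<oplus> h x) = (\<lambda>n. pushforward R \<phi> f n \<oplus> pushforward R \<phi> h n)"
proof
  fix n
  let ?S = "supp R f \<union> supp R h"
  have S: "finite ?S" "supp R (\<lambda>x. f x \<oplus> h x) \<subseteq> ?S"
    using f h by (auto simp: free_module_iff) (auto simp: supp_def)
  show "pushforward R \<phi> (\<lambda>x. f x \<oplus> h x) n = pushforward R \<phi> f n \<oplus> pushforward R \<phi> h n"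
    using f h by (simp add: pushforward_eq[OF free_module_add[OF f h] S] pushforward_eq[OF f S(1)]
        pushforward_eq[OF h S(1)] finsum_addf)
qed

lemma pushforward_smult:
  assumes f: "f \<in> carrier (free_module R M)" and c: "c \<in> carrier R"
  shows "pushforward R \<phi> (\<lambda>x. c \<otimes> f x) = (\<lambda>n. c \<otimes> pushforward R \<phi> f n)"
proof
  fix n
  have S: "finite (supp R f)" "supp R (\<lambda>x. c \<otimes> f x) \<subseteq> supp R f"
    using f c by (auto simp: free_module_iff) (auto simp: supp_def)
  show "pushforward R \<phi> (\<lambda>x. c \<otimes> f x) n = c \<otimes> pushforward R \<phi> f n"
    using f c S(1) by (simp add: pushforward_eq[OF free_module_mult[OF f] S]
        pushforward_eq[OF f S(1)] finsum_rdistr)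
qed

lemma pushforward_cong:
  assumes "f \<in> carrier (free_module R M)" "\<And>m. m \<in> M \<Longrightarrow> \<phi> m = \<psi> m"
  shows "pushforward R \<phi> f = pushforward R \<psi> f"
proof -
  have "{m \<in> supp R f. \<phi> m = n} = {m \<in> supp R f. \<psi> m = n}" for n
    using assms by (auto simp: free_module_iff)
  then show ?thesis
    by (simp add: pushforward_def)
qed

lemma pushforward_inj:
  assumes f: "f \<in> carrier (free_module R M)" and "inj_on \<phi> M" "m \<in> M"
  shows "pushforward R \<phi> f (\<phi> m) = f m"
proof -
  \<comment> \<open>The value at \<open>m\<close> may be zero; adjoining \<open>m\<close> to the
    support makes the fibre a singleton in either case.\<close>
  have "{x \<in> insert m (supp R f). \<phi> x = \<phi> m} = {m}"
    using assms by (auto simp: free_module_iff inj_on_def)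
  moreover have "finite (insert m (supp R f))"
    using f by (simp add: free_module_iff)
  ultimately show ?thesis
    using f by (subst pushforward_eq[where S = "insert m (supp R f)"]) auto
qed

lemma pushforward_id:
  assumes f: "f \<in> carrier (free_module R M)" and id: "\<And>m. m \<in> M \<Longrightarrow> \<phi> m = m"
  shows "pushforward R \<phi> f = f"
proof -
  have "pushforward R \<phi> f = pushforward R id f"
    using f id by (intro pushforward_cong) auto
  \<comment> \<open>Regarding \<open>f\<close> as a function on \<open>UNIV\<close> also covers the
    points outside \<open>M\<close>.\<close>
  moreover have "pushforward R id f m = f m" for m
    using pushforward_inj[of f UNIV id m] f free_module_mono[of M UNIV] by auto
  ultimately show ?thesis
    by auto
qed

text \<open>The fibre of the composite over \<open>n\<close> is the disjoint union of the fibres of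
  \<open>\<psi>\<close> over the points that \<open>\<phi>\<close> sends to
  \<open>n\<close>.\<close>

lemma pushforward_comp:
  assumes f: "f \<in> carrier (free_module R M)"
  shows "pushforward R \<phi> (pushforward R \<psi> f) = pushforward R (\<lambda>m. \<phi> (\<psi> m)) f"
proof
  fix n
  let ?S = "supp R f"
  let ?I = "{m \<in> \<psi> ` ?S. \<phi> m = n}"
  have fin: "finite ?S"
    using f by (simp add: free_module_iff)
  \<comment> \<open>The image of the support is a finite set that carries the inner pushforward, so
    the outer sum can be taken over it.\<close>
  have g: "pushforward R \<psi> f \<in> carrier (free_module R (\<psi> ` ?S))"
    using f by (intro pushforward_closed[where M = ?S]) (auto simp: free_module_iff)
  then have "pushforward R \<phi> (pushforward R \<psi> f) n = (\<Oplus>m\<in>?I. pushforward R \<psi> f m)"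
    by (intro pushforward_eq[OF g]) (use fin in \<open>auto simp: free_module_iff\<close>)
  also have "\<dots> = (\<Oplus>m\<in>?I. \<Oplus>x\<in>{x \<in> ?S. \<psi> x = m}. f x)"
    by (simp add: pushforward_def)
  also have "\<dots> = (\<Oplus>x\<in>(\<Union>m\<in>?I. {x \<in> ?S. \<psi> x = m}). f x)"
    by (rule add.finprod_UN_disjoint[symmetric]) (use fin f in \<open>auto simp: pairwise_def disjnt_def\<close>)
  also have "(\<Union>m\<in>?I. {x \<in> ?S. \<psi> x = m}) = {x \<in> ?S. \<phi> (\<psi> x) = n}"
    by auto
  finally show "pushforward R \<phi> (pushforward R \<psi> f) n = pushforward R (\<lambda>m. \<phi> (\<psi> m)) f n"
    by (simp add: pushforward_def)
qed

lemma module_hom_pushforward: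
  assumes "\<phi> \<in> M \<rightarrow> N"
  shows "module_hom R (free_module R M) (free_module R N) (pushforward R \<phi>)"
  using assms
  by (auto simp: module_hom_def module_free_module pushforward_closed pushforward_add pushforward_smult)

end

section \<open>Tensor products of finitely supported functions\<close>

text \<open>The elementary tensor of \<open>f\<close> and \<open>h\<close> under the identification
  of K[M] \<otimes> K[N] with K[M x N].\<close>

definition tensor :: "('k, 'm) ring_scheme \<Rightarrow> ('a \<Rightarrow> 'k) \<Rightarrow> ('b \<Rightarrow> 'k) \<Rightarrow> 'a \<times> 'b \<Rightarrow> 'k"
  where "tensor K f h = (\<lambda>p. f (fst p) \<otimes>\<^bsub>K\<^esub> h (snd p))"

context cring
begin

lemma tensor_closed:
  assumes "f \<in> carrier (free_module R M)" "h \<in> carrier (free_module R N)"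
  shows "tensor R f h \<in> carrier (free_module R (M \<times> N))"
  using assms
  by (intro free_moduleI[where S = "supp R f \<times> supp R h"])
     (auto simp: tensor_def free_module_iff supp_def)

lemma finsum_Times:
  assumes "finite A" "finite B" "f \<in> A \<rightarrow> carrier R" "h \<in> B \<rightarrow> carrier R"
  shows "(\<Oplus>p\<in>A \<times> B. f (fst p) \<otimes> h (snd p)) = (\<Oplus>x\<in>A. f x) \<otimes> (\<Oplus>y\<in>B. h y)"
proof -
  have "(\<Oplus>p\<in>A \<times> B. f (fst p) \<otimes> h (snd p)) = (\<Oplus>p\<in>(\<Union>x\<in>A. Pair x ` B). f (fst p) \<otimes> h (snd p))"
    by (rule arg_cong[where f = "finsum R _"]) auto
  also have "\<dots> = (\<Oplus>x\<in>A. \<Oplus>p\<in>Pair x ` B. f (fst p) \<otimes> h (snd p))"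
    using assms by (intro add.finprod_UN_disjoint) (auto simp: pairwise_def disjnt_def Pi_iff)
  also have "\<dots> = (\<Oplus>x\<in>A. f x \<otimes> (\<Oplus>y\<in>B. h y))"
    using assms
    by (intro finsum_cong') (auto simp: finsum_reindex inj_on_def Pi_iff finsum_rdistr)
  finally show ?thesis
    using assms by (simp add: finsum_ldistr)
qed

text \<open>The fibre of a product map is a product of fibres, over which a double sum of products
  factorises.\<close>

lemma pushforward_tensor:
  assumes f: "f \<in> carrier (free_module R M)" and h: "h \<in> carrier (free_module R N)"
  shows "pushforward R (map_prod \<phi> \<psi>) (tensor R f h) =
    tensor R (pushforward R \<phi> f) (pushforward R \<psi> h)"
proof
  fix p
  have "pushforward R (map_prod \<phi> \<psi>) (tensor R f h) p =
      (\<Oplus>q\<in>{q \<in> supp R f \<times> supp R h. map_prod \<phi> \<psi> q = p}. tensor R f h q)"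
    using f h by (intro pushforward_eq[OF tensor_closed[OF f h]])
      (auto simp: free_module_iff supp_def tensor_def)
  also have "{q \<in> supp R f \<times> supp R h. map_prod \<phi> \<psi> q = p} =
      {x \<in> supp R f. \<phi> x = fst p} \<times> {y \<in> supp R h. \<psi> y = snd p}"
    by (auto simp: prod_eq_iff)
  finally show "pushforward R (map_prod \<phi> \<psi>) (tensor R f h) p =
      tensor R (pushforward R \<phi> f) (pushforward R \<psi> h) p"
    using f h by (simp add: tensor_def pushforward_def finsum_Times free_module_iff)
qed

section \<open>Group algebras\<close>

lemma group_algebra_simps [simp]:
  "carrier (group_algebra R G) = carrier (free_module R (carrier G))"
  "\<zero>\<^bsub>group_algebra R G\<^esub> = (\<lambda>x. \<zero>)"
  "f \<oplus>\<^bsub>group_algebra R G\<^esub> h = (\<lambda>x. f x \<oplus> h x)"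
  "c \<odot>\<^bsub>group_algebra R G\<^esub> f = (\<lambda>x. c \<otimes> f x)"
  "\<one>\<^bsub>group_algebra R G\<^esub> = delta R \<one>\<^bsub>G\<^esub>"
  by (simp_all add: group_algebra_def free_module_def)

text \<open>With this description the ring axioms follow from the functoriality of pushforwards, without
  any manipulation of double sums.\<close>

lemma group_algebra_mult:
  assumes f: "f \<in> carrier (free_module R M)" and h: "h \<in> carrier (free_module R N)"
  shows "f \<otimes>\<^bsub>group_algebra R G\<^esub> h = pushforward R (\<lambda>p. fst p \<otimes>\<^bsub>G\<^esub> snd p) (tensor R f h)"
proof
  fix z
  have "pushforward R (\<lambda>p. fst p \<otimes>\<^bsub>G\<^esub> snd p) (tensor R f h) z =
      (\<Oplus>p\<in>{p \<in> supp R f \<times> supp R h. fst p \<otimes>\<^bsub>G\<^esub> snd p = z}. tensor R f h p)"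
    using f h by (intro pushforward_eq[OF tensor_closed[OF f h]])
      (auto simp: free_module_iff supp_def tensor_def)
  also have "{p \<in> supp R f \<times> supp R h. fst p \<otimes>\<^bsub>G\<^esub> snd p = z} =
      {(x, y). x \<in> supp R f \<and> y \<in> supp R h \<and> x \<otimes>\<^bsub>G\<^esub> y = z}"
    by auto
  finally show "(f \<otimes>\<^bsub>group_algebra R G\<^esub> h) z =
      pushforward R (\<lambda>p. fst p \<otimes>\<^bsub>G\<^esub> snd p) (tensor R f h) z"
    by (simp add: group_algebra_def tensor_def)
qed

text \<open>Tensoring with \<open>delta R g\<close> moves \<open>f\<close> to the slice over
  \<open>g\<close>, which the group law then translates. This yields the unit laws and identifies
  \<open>Z_*\<close> with multiplication by an element.\<close>

lemma delta_mult_left: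
  assumes f: "f \<in> carrier (free_module R M)"
  shows "delta R g \<otimes>\<^bsub>group_algebra R G\<^esub> f = pushforward R (\<lambda>x. g \<otimes>\<^bsub>G\<^esub> x) f"
proof -
  have *: "tensor R (delta R g) f = pushforward R (Pair g) f"
  proof
    fix p
    show "tensor R (delta R g) f p = pushforward R (Pair g) f p"
    proof (cases "fst p = g")
      case True
      then have "pushforward R (Pair g) f (Pair g (snd p)) = f (snd p)"
        using f free_module_mono[of M UNIV] by (intro pushforward_inj[of f UNIV]) (auto simp: inj_on_def)
      with True f show ?thesis
        by (cases p) (auto simp: tensor_def delta_def)
    next
      case False
      have "pushforward R (Pair g) f \<in> carrier (free_module R ({g} \<times> M))"
        using f by (rule pushforward_closed) auto
      with False f show ?thesis
        using free_module_outside[of "pushforward R (Pair g) f" "{g} \<times> M" p]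
        by (cases p) (auto simp: tensor_def delta_def)
    qed
  qed
  show ?thesis
    by (simp add: group_algebra_mult[OF delta_in_free_module[of g UNIV] f] * pushforward_comp[OF f])
qed

lemma delta_mult_right:
  assumes f: "f \<in> carrier (free_module R M)"
  shows "f \<otimes>\<^bsub>group_algebra R G\<^esub> delta R g = pushforward R (\<lambda>x. x \<otimes>\<^bsub>G\<^esub> g) f"
proof -
  have *: "tensor R f (delta R g) = pushforward R (\<lambda>x. (x, g)) f"
  proof
    fix p
    show "tensor R f (delta R g) p = pushforward R (\<lambda>x. (x, g)) f p"
    proof (cases "snd p = g")
      case True
      have "pushforward R (\<lambda>x. (x, g)) f ((\<lambda>x. (x, g)) (fst p)) = f (fst p)"
        using f free_module_mono[of M UNIV] by (intro pushforward_inj[of f UNIV]) (auto simp: inj_on_def)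
      with True f show ?thesis
        by (cases p) (auto simp: tensor_def delta_def)
    next
      case False
      have "pushforward R (\<lambda>x. (x, g)) f \<in> carrier (free_module R (M \<times> {g}))"
        using f by (rule pushforward_closed) auto
      with False f show ?thesis
        using free_module_outside[of "pushforward R (\<lambda>x. (x, g)) f" "M \<times> {g}" p]
        by (cases p) (auto simp: tensor_def delta_def)
    qed
  qed
  show ?thesis
    by (simp add: group_algebra_mult[OF f delta_in_free_module[of g UNIV]] * pushforward_comp[OF f])
qed

text \<open>Nested pairs on the two sides have different types, so associativity holds up to
  rebracketing, which is itself a pushforward.\<close>

lemma tensor_assoc:
  fixes f :: "'x \<Rightarrow> 'a" and g :: "'y \<Rightarrow> 'a" and h :: "'z \<Rightarrow> 'a"
  assumes "f \<in> carrier (free_module R M)" "g \<in> carrier (free_module R N)"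
    "h \<in> carrier (free_module R P)"
  shows "tensor R f (tensor R g h) = pushforward R (\<lambda>((x, y), z). (x, y, z)) (tensor R (tensor R f g) h)"
proof
  fix p :: "'x \<times> 'y \<times> 'z"
  obtain x y z where p: "p = (x, y, z)"
    by (cases p)
  have "tensor R (tensor R f g) h \<in> carrier (free_module R UNIV)"
    by (rule subsetD[OF free_module_mono[OF subset_UNIV] tensor_closed[OF tensor_closed[OF assms(1,2)] assms(3)]])
  then have "pushforward R (\<lambda>((x, y), z). (x, y, z)) (tensor R (tensor R f g) h)
      ((\<lambda>((x, y), z). (x, y, z)) ((x, y), z)) = tensor R (tensor R f g) h ((x, y), z)"
    by (rule pushforward_inj) (simp_all add: inj_on_def split_paired_all)
  then show "tensor R f (tensor R g h) p =
      pushforward R (\<lambda>((x, y), z). (x, y, z)) (tensor R (tensor R f g) h) p"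
    using assms by (simp add: p tensor_def m_assoc)
qed

lemma group_algebra_mult_closed:
  assumes "monoid G" "f \<in> carrier (free_module R (carrier G))" "h \<in> carrier (free_module R (carrier G))"
  shows "f \<otimes>\<^bsub>group_algebra R G\<^esub> h \<in> carrier (free_module R (carrier G))"
  unfolding group_algebra_mult[OF assms(2,3)]
  by (rule pushforward_closed[OF tensor_closed[OF assms(2,3)]])
     (auto intro: monoid.m_closed[OF assms(1)])

text \<open>Both sides are pushforwards of one triple tensor, along (xy)z and x(yz)
  respectively.\<close>

lemma group_algebra_assoc:
  assumes G: "monoid G"
    and f: "f \<in> carrier (free_module R (carrier G))"
    and g: "g \<in> carrier (free_module R (carrier G))"
    and h: "h \<in> carrier (free_module R (carrier G))"
  shows "(f \<otimes>\<^bsub>group_algebra R G\<^esub> g) \<otimes>\<^bsub>group_algebra R G\<^esub> h =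
    f \<otimes>\<^bsub>group_algebra R G\<^esub> (g \<otimes>\<^bsub>group_algebra R G\<^esub> h)"
proof -
  let ?m = "\<lambda>p. fst p \<otimes>\<^bsub>G\<^esub> snd p"
  note fg = tensor_closed[OF f g] and gh = tensor_closed[OF g h]
  note fgh = tensor_closed[OF fg h] and fgh' = tensor_closed[OF f gh]
  \<comment> \<open>The pushforward along \<open>id\<close> is inserted so that both tensor factors
    are pushforwards and combine into one along a \<open>map_prod\<close>.\<close>
  have "(f \<otimes>\<^bsub>group_algebra R G\<^esub> g) \<otimes>\<^bsub>group_algebra R G\<^esub> h =
      pushforward R ?m (tensor R (pushforward R ?m (tensor R f g)) (pushforward R id h))"
    using group_algebra_mult[where G = G, OF group_algebra_mult_closed[OF G f g] h]
    by (simp add: group_algebra_mult[OF f g] pushforward_id[OF h, of id])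
  also have "\<dots> = pushforward R (\<lambda>p. ?m (map_prod ?m id p)) (tensor R (tensor R f g) h)"
    by (simp add: pushforward_tensor[OF fg h, symmetric] pushforward_comp[OF fgh])
  also have "\<dots> = pushforward R (\<lambda>p. ?m (map_prod id ?m ((\<lambda>((x, y), z). (x, y, z)) p)))
      (tensor R (tensor R f g) h)"
    \<comment> \<open>Associativity of \<open>G\<close> enters here, on the basis elements.\<close>
    by (rule pushforward_cong[OF fgh]) (auto simp: monoid.m_assoc[OF G])
  also have "\<dots> = pushforward R (\<lambda>p. ?m (map_prod id ?m p)) (tensor R f (tensor R g h))"
    by (simp add: tensor_assoc[OF f g h] pushforward_comp[OF fgh])
  also have "\<dots> = pushforward R ?m (tensor R (pushforward R id f) (pushforward R ?m (tensor R g h)))"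
    by (simp add: pushforward_tensor[OF f gh, symmetric] pushforward_comp[OF fgh'])
  also have "\<dots> = f \<otimes>\<^bsub>group_algebra R G\<^esub> (g \<otimes>\<^bsub>group_algebra R G\<^esub> h)"
    using group_algebra_mult[where G = G, OF f group_algebra_mult_closed[OF G g h]]
    by (simp add: group_algebra_mult[OF g h] pushforward_id[OF f, of id])
  finally show ?thesis .
qed

lemma assoc_algebra_group_algebra:
  assumes G: "monoid G"
  shows "assoc_algebra R (group_algebra R G)"
proof -
  interpret G: monoid G by fact
  let ?A = "group_algebra R G"
  \<comment> \<open>The module axioms see only the additive and scalar fields, which are those of
    the free module.\<close>
  have mod: "module R ?A"
    using module_free_module[of "carrier G"]
    by (simp add: group_algebra_def module_def abelian_group_def module_axioms_def
        abelian_monoid_def abelian_group_axioms_def)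
  have "monoid ?A"
    by (rule monoidI) (auto simp: group_algebra_mult_closed[OF G] group_algebra_assoc[OF G]
        delta_in_free_module delta_mult_left delta_mult_right pushforward_id)
  moreover have "(f \<oplus>\<^bsub>?A\<^esub> g) \<otimes>\<^bsub>?A\<^esub> h = f \<otimes>\<^bsub>?A\<^esub> h \<oplus>\<^bsub>?A\<^esub> g \<otimes>\<^bsub>?A\<^esub> h"
      "h \<otimes>\<^bsub>?A\<^esub> (f \<oplus>\<^bsub>?A\<^esub> g) = h \<otimes>\<^bsub>?A\<^esub> f \<oplus>\<^bsub>?A\<^esub> h \<otimes>\<^bsub>?A\<^esub> g"
    if "f \<in> carrier ?A" "g \<in> carrier ?A" "h \<in> carrier ?A" for f g h
  proof -
    have fgh: "f \<in> carrier (free_module R (carrier G))" "g \<in> carrier (free_module R (carrier G))"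
        "h \<in> carrier (free_module R (carrier G))"
      using that by auto
    have "tensor R (\<lambda>x. f x \<oplus> g x) h = (\<lambda>p. tensor R f h p \<oplus> tensor R g h p)"
        "tensor R h (\<lambda>x. f x \<oplus> g x) = (\<lambda>p. tensor R h f p \<oplus> tensor R h g p)"
      using fgh by (auto simp: tensor_def l_distr r_distr)
    then show "(f \<oplus>\<^bsub>?A\<^esub> g) \<otimes>\<^bsub>?A\<^esub> h = f \<otimes>\<^bsub>?A\<^esub> h \<oplus>\<^bsub>?A\<^esub> g \<otimes>\<^bsub>?A\<^esub> h"
      "h \<otimes>\<^bsub>?A\<^esub> (f \<oplus>\<^bsub>?A\<^esub> g) = h \<otimes>\<^bsub>?A\<^esub> f \<oplus>\<^bsub>?A\<^esub> h \<otimes>\<^bsub>?A\<^esub> g"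
      by (simp_all add: group_algebra_mult[OF free_module_add[OF fgh(1,2)] fgh(3)]
          group_algebra_mult[OF fgh(3) free_module_add[OF fgh(1,2)]]
          group_algebra_mult[OF fgh(1) fgh(3)] group_algebra_mult[OF fgh(2) fgh(3)]
          group_algebra_mult[OF fgh(3) fgh(1)] group_algebra_mult[OF fgh(3) fgh(2)]
          pushforward_add[OF tensor_closed[OF fgh(1,3)] tensor_closed[OF fgh(2,3)]]
          pushforward_add[OF tensor_closed[OF fgh(3,1)] tensor_closed[OF fgh(3,2)]])
  qed
  ultimately have "ring ?A"
    using mod by (intro ringI) (auto simp: module_def)
  moreover have "(c \<odot>\<^bsub>?A\<^esub> f) \<otimes>\<^bsub>?A\<^esub> h = c \<odot>\<^bsub>?A\<^esub> (f \<otimes>\<^bsub>?A\<^esub> h)"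
      "f \<otimes>\<^bsub>?A\<^esub> (c \<odot>\<^bsub>?A\<^esub> h) = c \<odot>\<^bsub>?A\<^esub> (f \<otimes>\<^bsub>?A\<^esub> h)"
    if c: "c \<in> carrier R" and "f \<in> carrier ?A" "h \<in> carrier ?A" for c f h
  proof -
    have f: "f \<in> carrier (free_module R (carrier G))" and h: "h \<in> carrier (free_module R (carrier G))"
      using that by auto
    have "tensor R (\<lambda>x. c \<otimes> f x) h = (\<lambda>p. c \<otimes> tensor R f h p)"
        "tensor R f (\<lambda>x. c \<otimes> h x) = (\<lambda>p. c \<otimes> tensor R f h p)"
      using f h c by (auto simp: tensor_def m_assoc m_lcomm)
    then show "(c \<odot>\<^bsub>?A\<^esub> f) \<otimes>\<^bsub>?A\<^esub> h = c \<odot>\<^bsub>?A\<^esub> (f \<otimes>\<^bsub>?A\<^esub> h)"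
      "f \<otimes>\<^bsub>?A\<^esub> (c \<odot>\<^bsub>?A\<^esub> h) = c \<odot>\<^bsub>?A\<^esub> (f \<otimes>\<^bsub>?A\<^esub> h)"
      using c by (simp_all add: group_algebra_mult[OF f h] group_algebra_mult[OF free_module_mult[OF f] h]
          group_algebra_mult[OF f free_module_mult[OF h]] pushforward_smult[OF tensor_closed[OF f h]])
  qed
  ultimately show ?thesis
    using mod by (auto simp: assoc_algebra_def assoc_algebra_axioms_def)
qed

text \<open>Both sides of multiplicativity push the same tensor forward, along \<phi>(xy) and
  \<phi>(x)\<phi>(y). Preservation of the unit is assumed separately because \<open>hom\<close> does
  not include it for monoids.\<close>

lemma algebra_hom_pushforward:
  assumes G: "monoid G" and H: "monoid H" and hom: "\<phi> \<in> hom G H" and one: "\<phi> \<one>\<^bsub>G\<^esub> = \<one>\<^bsub>H\<^esub>"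
  shows "algebra_hom R (group_algebra R G) (group_algebra R H) (pushforward R \<phi>)"
proof -
  have \<phi>: "\<phi> \<in> carrier G \<rightarrow> carrier H"
    using hom by (simp add: hom_def)
  have "pushforward R \<phi> (f \<otimes>\<^bsub>group_algebra R G\<^esub> h) =
      pushforward R \<phi> f \<otimes>\<^bsub>group_algebra R H\<^esub> pushforward R \<phi> h"
    if f: "f \<in> carrier (free_module R (carrier G))" and h: "h \<in> carrier (free_module R (carrier G))"
    for f h
  proof -
    note fh = tensor_closed[OF f h]
    have "pushforward R \<phi> (f \<otimes>\<^bsub>group_algebra R G\<^esub> h) =
        pushforward R (\<lambda>p. \<phi> (fst p \<otimes>\<^bsub>G\<^esub> snd p)) (tensor R f h)"
      by (simp add: group_algebra_mult[OF f h] pushforward_comp[OF fh])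
    also have "\<dots> = pushforward R (\<lambda>p. fst (map_prod \<phi> \<phi> p) \<otimes>\<^bsub>H\<^esub> snd (map_prod \<phi> \<phi> p)) (tensor R f h)"
      by (rule pushforward_cong[OF fh]) (auto simp: hom_mult[OF hom])
    also have "\<dots> = pushforward R (\<lambda>p. fst p \<otimes>\<^bsub>H\<^esub> snd p) (pushforward R (map_prod \<phi> \<phi>) (tensor R f h))"
      by (simp only: pushforward_comp[OF fh])
    finally show ?thesis
      by (simp add: pushforward_tensor[OF f h]
          group_algebra_mult[OF pushforward_closed[OF f \<phi>] pushforward_closed[OF h \<phi>]])
  qed
  moreover have "module R (group_algebra R G)" "module R (group_algebra R H)"
    using assoc_algebra_group_algebra[OF G] assoc_algebra_group_algebra[OF H]
    by (auto simp: assoc_algebra_def)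
  ultimately show ?thesis
    using \<phi> by (auto simp: algebra_hom_def assoc_algebra_group_algebra G H module_hom_def ring_hom_def
        pushforward_closed pushforward_add pushforward_smult pushforward_delta[OF is_cring] one)
qed

end

section \<open>Eigenspaces of an involution\<close>

lemma module_homD:
  assumes "module_hom K M N h"
  shows "x \<in> carrier M \<Longrightarrow> h x \<in> carrier N"
    and "x \<in> carrier M \<Longrightarrow> y \<in> carrier M \<Longrightarrow> h (x \<oplus>\<^bsub>M\<^esub> y) = h x \<oplus>\<^bsub>N\<^esub> h y"
    and "c \<in> carrier K \<Longrightarrow> x \<in> carrier M \<Longrightarrow> h (c \<odot>\<^bsub>M\<^esub> x) = c \<odot>\<^bsub>N\<^esub> h x"
  using assms by (auto simp: module_hom_def)

context module
begin

lemma module_hom_zero: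
  assumes h: "module_hom R M N h"
  shows "h \<zero>\<^bsub>M\<^esub> = \<zero>\<^bsub>N\<^esub>"
proof -
  interpret N: module R N
    using h by (simp add: module_hom_def)
  show ?thesis
    using module_homD(3)[OF h, of \<zero> "\<zero>\<^bsub>M\<^esub>"] module_homD(1)[OF h, of "\<zero>\<^bsub>M\<^esub>"] by simp
qed

lemma module_hom_minus:
  assumes h: "module_hom R M N h" and x: "x \<in> carrier M"
  shows "h (\<ominus>\<^bsub>M\<^esub> x) = \<ominus>\<^bsub>N\<^esub> h x"
proof -
  interpret N: module R N
    using h by (simp add: module_hom_def)
  show ?thesis
    using module_homD(3)[OF h, of "\<ominus> \<one>" x] module_homD(1)[OF h x] x
    by (simp add: smult_l_minus N.smult_l_minus)
qed

lemma submodule_eigenspace: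
  assumes T: "module_hom R M M T" and c: "c \<in> carrier R"
  shows "submodule (eigenspace M T c) R M"
  using c by (intro submoduleI)
    (auto simp: eigenspace_def module_homD[OF T] module_hom_zero[OF T] module_hom_minus[OF T]
      smult_r_distr smult_r_minus simp flip: smult_assoc1 intro!: arg_cong2[where f = "smult M"] R.m_comm)

lemma smult_half_double:
  assumes "\<one> \<oplus> \<one> \<in> Units R" and x: "x \<in> carrier M"
  shows "inv (\<one> \<oplus> \<one>) \<odot>\<^bsub>M\<^esub> (x \<oplus>\<^bsub>M\<^esub> x) = x"
proof -
  have "x \<oplus>\<^bsub>M\<^esub> x = (\<one> \<oplus> \<one>) \<odot>\<^bsub>M\<^esub> x"
    using x by (simp add: smult_l_distr)
  then show ?thesis
    using assms by (simp flip: smult_assoc1)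
qed

text \<open>Existence comes from x = (x + Tx)/2 + (x - Tx)/2. For uniqueness, Tx = x and Tx = -x
  give 2x = 0.\<close>

lemma eigenspace_direct_sum:
  assumes two: "\<one> \<oplus> \<one> \<in> Units R" and T: "module_hom R M M T"
    and invol: "\<And>x. x \<in> carrier M \<Longrightarrow> T (T x) = x"
  shows "internal_direct_sum R M (eigenspace M T \<one>) (eigenspace M T (\<ominus> \<one>))"
proof -
  let ?h = "inv (\<one> \<oplus> \<one>)"
  let ?U = "eigenspace M T \<one>" and ?V = "eigenspace M T (\<ominus> \<one>)"
  have h: "?h \<in> carrier R"
    using two by simp
  have U: "submodule ?U R M" and V: "submodule ?V R M"
    using submodule_eigenspace[OF T] by auto
  have "x \<in> ?U <+>\<^bsub>M\<^esub> ?V" if x: "x \<in> carrier M" for x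
  proof -
    have Tx: "T x \<in> carrier M"
      using module_homD(1)[OF T x] .
    have "?h \<odot>\<^bsub>M\<^esub> (x \<oplus>\<^bsub>M\<^esub> T x) \<in> ?U"
      using x Tx h by (simp add: eigenspace_def module_homD[OF T] invol M.a_comm)
    moreover have "?h \<odot>\<^bsub>M\<^esub> (x \<oplus>\<^bsub>M\<^esub> \<ominus>\<^bsub>M\<^esub> T x) \<in> ?V"
      using x Tx h by (simp add: eigenspace_def module_homD[OF T] module_hom_minus[OF T] invol
          M.a_comm smult_l_minus M.minus_add M.minus_minus flip: smult_r_minus)
    moreover have "x = ?h \<odot>\<^bsub>M\<^esub> (x \<oplus>\<^bsub>M\<^esub> T x) \<oplus>\<^bsub>M\<^esub> ?h \<odot>\<^bsub>M\<^esub> (x \<oplus>\<^bsub>M\<^esub> \<ominus>\<^bsub>M\<^esub> T x)"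
    proof -
      have "x \<oplus>\<^bsub>M\<^esub> T x \<oplus>\<^bsub>M\<^esub> (x \<oplus>\<^bsub>M\<^esub> \<ominus>\<^bsub>M\<^esub> T x) = x \<oplus>\<^bsub>M\<^esub> x"
        using x Tx by (metis M.a_assoc M.a_closed M.a_comm M.a_inv_closed M.r_neg M.r_zero)
      with x Tx h smult_half_double[OF two x] show ?thesis
        by (simp flip: smult_r_distr)
    qed
    ultimately show ?thesis
      unfolding set_add_def' by blast
  qed
  then have "?U <+>\<^bsub>M\<^esub> ?V = carrier M"
    by (auto simp: set_add_def' eigenspace_def)
  moreover have "x = \<zero>\<^bsub>M\<^esub>" if "x \<in> ?U" "x \<in> ?V" for x
  proof -
    have x: "x \<in> carrier M" and "\<ominus>\<^bsub>M\<^esub> x = x"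
      using that by (auto simp: eigenspace_def smult_l_minus)
    then have "x \<oplus>\<^bsub>M\<^esub> x = \<zero>\<^bsub>M\<^esub>"
      using M.r_neg by fastforce
    then show ?thesis
      using smult_half_double[OF two x] h by simp
  qed
  then have "?U \<inter> ?V = {\<zero>\<^bsub>M\<^esub>}"
    using h by (auto simp: eigenspace_def module_hom_zero[OF T])
  ultimately show ?thesis
    using U V by (simp add: internal_direct_sum_def module_axioms)
qed

end

text \<open>Linearity and multiplicativity of \<open>T\<close> are assumed, with no reference to the
  unit, so that the result applies to an ideal whose unit differs from that of the algebra.\<close>

lemma (in assoc_algebra) super_algebra_wrt_involution:
  assumes two: "\<one> \<oplus> \<one> \<in> Units R" and T: "module_hom R M M T"
    and mult: "\<And>x y. x \<in> carrier M \<Longrightarrow> y \<in> carrier M \<Longrightarrow> T (x \<otimes>\<^bsub>M\<^esub> y) = T x \<otimes>\<^bsub>M\<^esub> T y"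
    and invol: "\<And>x. x \<in> carrier M \<Longrightarrow> T (T x) = x"
  shows "super_algebra_wrt R M T"
proof -
  have [simp]: "\<ominus> \<one> \<otimes> \<ominus> \<one> = \<one>"
    by (simp add: R.l_minus R.r_minus R.minus_minus)
  \<comment> \<open>Eigenvalues multiply. The four choices of signs give the four grading rules; odd
    times odd is even because (-1)(-1) = 1.\<close>
  have "x \<otimes>\<^bsub>M\<^esub> y \<in> eigenspace M T (a \<otimes> b)"
    if "a \<in> carrier R" "b \<in> carrier R" "x \<in> eigenspace M T a" "y \<in> eigenspace M T b" for a b x y
    using that by (simp add: eigenspace_def mult smult_mult_left smult_mult_right R.m_comm
        flip: smult_assoc1)
  from this[of \<one> \<one>] this[of "\<ominus> \<one>" \<one>] this[of \<one> "\<ominus> \<one>"] this[of "\<ominus> \<one>" "\<ominus> \<one>"]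
  show ?thesis
    using eigenspace_direct_sum[OF two T invol] T
    by (auto simp: super_algebra_wrt_def super_algebra_def assoc_algebra_axioms)
qed

section \<open>Ideals that are unital algebras\<close>

context assoc_algebra
begin

text \<open>Two units \<open>u\<close> and \<open>v\<close> of \<open>I\<close> satisfy v = vu = u,
  so exhibiting one unit determines the definite description.\<close>

lemma one_ideal_algebra:
  assumes "u \<in> I" "\<And>x. x \<in> I \<Longrightarrow> u \<otimes>\<^bsub>M\<^esub> x = x \<and> x \<otimes>\<^bsub>M\<^esub> u = x"
  shows "\<one>\<^bsub>ideal_algebra M I\<^esub> = u"
proof -
  have "(THE v. v \<in> I \<and> (\<forall>x\<in>I. v \<otimes>\<^bsub>M\<^esub> x = x \<and> x \<otimes>\<^bsub>M\<^esub> v = x)) = u"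
  proof (rule the_equality)
    fix v assume "v \<in> I \<and> (\<forall>x\<in>I. v \<otimes>\<^bsub>M\<^esub> x = x \<and> x \<otimes>\<^bsub>M\<^esub> v = x)"
    then show "v = u"
      using assms by metis
  qed (use assms in simp)
  then show ?thesis
    by (simp add: ideal_algebra_def)
qed

lemma ideal_algebra_simps [simp]:
  "carrier (ideal_algebra M I) = I"
  "x \<otimes>\<^bsub>ideal_algebra M I\<^esub> y = x \<otimes>\<^bsub>M\<^esub> y"
  "x \<oplus>\<^bsub>ideal_algebra M I\<^esub> y = x \<oplus>\<^bsub>M\<^esub> y"
  "\<zero>\<^bsub>ideal_algebra M I\<^esub> = \<zero>\<^bsub>M\<^esub>"
  "c \<odot>\<^bsub>ideal_algebra M I\<^esub> x = c \<odot>\<^bsub>M\<^esub> x"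
  by (simp_all add: ideal_algebra_def)

lemma assoc_algebra_ideal_algebra:
  assumes sub: "submodule I R M" and I: "ideal I M"
    and u: "u \<in> I" "\<And>x. x \<in> I \<Longrightarrow> u \<otimes>\<^bsub>M\<^esub> x = x \<and> x \<otimes>\<^bsub>M\<^esub> u = x"
  shows "assoc_algebra R (ideal_algebra M I)"
proof -
  interpret I: ideal I M by fact
  have sub': "x \<in> carrier M" if "x \<in> I" for x
    using submoduleE(1)[OF sub] that by blast
  have mod: "module R (ideal_algebra M I)"
    using submodule.submodule_is_module[OF sub module_axioms]
    by (simp add: ideal_algebra_def module_def abelian_group_def module_axioms_def
        abelian_monoid_def abelian_group_axioms_def)
  moreover have "monoid (ideal_algebra M I)"
    using sub' u I.I_l_closed
    by (intro monoidI) (auto simp: one_ideal_algebra[OF u] m_assoc)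
  then have "ring (ideal_algebra M I)"
    using mod sub' by (intro ringI) (auto simp: module_def l_distr r_distr)
  ultimately show ?thesis
    using sub' by (auto simp: assoc_algebra_def assoc_algebra_axioms_def smult_mult_left smult_mult_right)
qed

lemma super_algebra_wrt_ideal_algebra:
  assumes two: "\<one> \<oplus> \<one> \<in> Units R" and T: "algebra_hom R M M T"
    and invol: "\<And>x. x \<in> carrier M \<Longrightarrow> T (T x) = x"
    and sub: "submodule I R M" and I: "ideal I M"
    and u: "u \<in> I" "\<And>x. x \<in> I \<Longrightarrow> u \<otimes>\<^bsub>M\<^esub> x = x \<and> x \<otimes>\<^bsub>M\<^esub> u = x"
    and TI: "\<And>x. x \<in> I \<Longrightarrow> T x \<in> I"
  shows "super_algebra_wrt R (ideal_algebra M I) T"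
proof -
  interpret I: assoc_algebra R "ideal_algebra M I"
    using assoc_algebra_ideal_algebra[OF sub I u] .
  have sub': "x \<in> carrier M" if "x \<in> I" for x
    using submoduleE(1)[OF sub] that by blast
  have hom: "module_hom R M M T" "T \<in> ring_hom M M"
    using T by (auto simp: algebra_hom_def)
  show ?thesis
    using sub' TI
    by (intro I.super_algebra_wrt_involution[OF two])
       (auto simp: module_hom_def I.module_axioms module_homD[OF hom(1)]
         ring_hom_mult[OF hom(2)] invol)
qed

text \<open>For factors on the left, centrality moves \<open>z\<close> past \<open>x\<close>; for
  factors on the right, associativity is enough.\<close>

lemma ideal_eigenspace_central:
  assumes z: "z \<in> carrier M" and c: "c \<in> carrier R"
    and central: "\<And>x. x \<in> carrier M \<Longrightarrow> z \<otimes>\<^bsub>M\<^esub> x = x \<otimes>\<^bsub>M\<^esub> z"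
    and sub: "submodule (eigenspace M (\<lambda>x. z \<otimes>\<^bsub>M\<^esub> x) c) R M"
  shows "ideal (eigenspace M (\<lambda>x. z \<otimes>\<^bsub>M\<^esub> x) c) M"
proof (rule idealI)
  show "ring M" ..
  show "subgroup (eigenspace M (\<lambda>x. z \<otimes>\<^bsub>M\<^esub> x) c) (add_monoid M)"
    using sub by (simp add: submodule_def)
next
  fix a x assume a: "a \<in> eigenspace M (\<lambda>x. z \<otimes>\<^bsub>M\<^esub> x) c" and x: "x \<in> carrier M"
  then have "a \<in> carrier M"
    by (simp add: eigenspace_def)
  then have "z \<otimes>\<^bsub>M\<^esub> (x \<otimes>\<^bsub>M\<^esub> a) = x \<otimes>\<^bsub>M\<^esub> (z \<otimes>\<^bsub>M\<^esub> a)"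
    using x z central by (metis m_assoc)
  then show "x \<otimes>\<^bsub>M\<^esub> a \<in> eigenspace M (\<lambda>x. z \<otimes>\<^bsub>M\<^esub> x) c"
    using a x c by (simp add: eigenspace_def smult_mult_right)
  show "a \<otimes>\<^bsub>M\<^esub> x \<in> eigenspace M (\<lambda>x. z \<otimes>\<^bsub>M\<^esub> x) c"
    using a x z c by (auto simp: eigenspace_def smult_mult_left simp flip: m_assoc)
qed

end

text \<open>The unit of the ideal is mapped to \<open>1\<close>, although it is not the unit of \<open>A\<close>, because the ideal is
  mapped onto \<open>B\<close>.\<close>

lemma ideal_algebra_isomorphic:
  assumes h: "algebra_hom K A B h" and surj: "h ` carrier A = carrier B"
    and sum: "internal_direct_sum K A I (a_kernel A B h)" and I: "ideal I A"
    and u: "u \<in> I" "\<And>x. x \<in> I \<Longrightarrow> u \<otimes>\<^bsub>A\<^esub> x = x \<and> x \<otimes>\<^bsub>A\<^esub> u = x"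
  shows "algebra_isomorphic K (ideal_algebra A I) B"
proof -
  interpret A: assoc_algebra K A
    using h by (simp add: algebra_hom_def)
  interpret B: assoc_algebra K B
    using h by (simp add: algebra_hom_def)
  have hom: "module_hom K A B h" "h \<in> ring_hom A B"
    using h by (auto simp: algebra_hom_def)
  have sub: "submodule I K A"
    using sum by (simp add: internal_direct_sum_def)
  have sub': "x \<in> carrier A" if "x \<in> I" for x
    using A.submoduleE(1)[OF sub] that by blast
  have alg: "assoc_algebra K (ideal_algebra A I)"
    using A.assoc_algebra_ideal_algebra[OF sub I u] .
  \<comment> \<open>The component in \<open>I\<close> of any preimage has the same image, as the
    other component lies in the kernel.\<close>
  have onto: "\<exists>x\<in>I. h x = b" if "b \<in> carrier B" for b
  proof -
    have "b \<in> h ` carrier A"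
      using that surj by simp
    then obtain a where "h a = b" "a \<in> carrier A"
      by (elim imageE) simp
    moreover from \<open>a \<in> carrier A\<close> have "a \<in> I <+>\<^bsub>A\<^esub> a_kernel A B h"
      using sum by (simp add: internal_direct_sum_def)
    then obtain x y where "x \<in> I" "y \<in> a_kernel A B h" "a = x \<oplus>\<^bsub>A\<^esub> y"
      by (auto simp: set_add_def')
    ultimately show ?thesis
      using sub' by (intro bexI[of _ x]) (auto simp: a_kernel_def' module_homD[OF hom(1)])
  qed
  have inj: "inj_on h I"
  proof (rule inj_onI)
    fix x y assume xy: "x \<in> I" "y \<in> I" "h x = h y"
    then have "x \<oplus>\<^bsub>A\<^esub> \<ominus>\<^bsub>A\<^esub> y \<in> I \<inter> a_kernel A B h"
      using sub' A.submoduleE(3,5)[OF sub]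
      by (auto simp: a_kernel_def' module_homD[OF hom(1)] A.module_hom_minus[OF hom(1)] B.r_neg)
    then have "x \<oplus>\<^bsub>A\<^esub> \<ominus>\<^bsub>A\<^esub> y = \<zero>\<^bsub>A\<^esub>"
      using sum by (auto simp: internal_direct_sum_def)
    then show "x = y"
      using xy sub' by (metis A.minus_equality A.minus_minus A.a_inv_closed)
  qed
  have "h u = \<one>\<^bsub>B\<^esub>"
  proof -
    obtain x where x: "x \<in> I" "h x = \<one>\<^bsub>B\<^esub>"
      using onto[of "\<one>\<^bsub>B\<^esub>"] by auto
    have "h u \<otimes>\<^bsub>B\<^esub> h x = h x"
      using x u sub' by (metis ring_hom_mult[OF hom(2)])
    then show ?thesis
      using x u sub' by (simp add: module_homD[OF hom(1)])
  qed
  then have "h \<in> ring_hom (ideal_algebra A I) B"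
    using sub' by (auto simp: ring_hom_def A.one_ideal_algebra[OF u] module_homD[OF hom(1)]
        ring_hom_mult[OF hom(2)])
  moreover have "module_hom K (ideal_algebra A I) B h"
    using sub' alg hom(1) by (auto simp: module_hom_def assoc_algebra_def)
  moreover have "bij_betw h (carrier (ideal_algebra A I)) (carrier B)"
    using inj onto sub' by (auto simp: bij_betw_def module_homD[OF hom(1)] image_iff)
  ultimately show ?thesis
    using alg B.assoc_algebra_axioms by (auto simp: algebra_isomorphic_def algebra_hom_def)
qed

text \<open>The restricted projection leads from the plus part to the quotient algebra, whereas the
  claim about the image of \<open>\<pi>_*\<close> asks for the opposite direction.\<close>

lemma algebra_isomorphic_sym:
  assumes "algebra_isomorphic K A B"
  shows "algebra_isomorphic K B A"
proof -
  obtain h where h: "algebra_hom K A B h" and bij: "bij_betw h (carrier A) (carrier B)"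
    using assms by (auto simp: algebra_isomorphic_def)
  interpret A: assoc_algebra K A
    using h by (simp add: algebra_hom_def)
  interpret B: assoc_algebra K B
    using h by (simp add: algebra_hom_def)
  have hom: "module_hom K A B h" "h \<in> ring_hom A B"
    using h by (auto simp: algebra_hom_def)
  define k where "k = inv_into (carrier A) h"
  have k: "k y \<in> carrier A" "h (k y) = y" if "y \<in> carrier B" for y
    using that bij by (auto simp: k_def bij_betw_def inv_into_into f_inv_into_f)
  have k': "k y = x" if "x \<in> carrier A" "h x = y" for x y
    using that bij by (auto simp: k_def bij_betw_def)
  have "module_hom K B A k"
    unfolding module_hom_def
    using k by (auto intro!: k' simp: module_homD[OF hom(1)] A.module_axioms B.module_axioms)
  moreover have "k \<in> ring_hom B A"
    using k by (intro ring_hom_memI)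
      (auto intro!: k' simp: module_homD[OF hom(1)] ring_hom_mult[OF hom(2)] ring_hom_one[OF hom(2)])
  moreover have "bij_betw k (carrier B) (carrier A)"
    using bij by (simp add: k_def bij_betw_inv_into)
  ultimately show ?thesis
    using A.assoc_algebra_axioms B.assoc_algebra_axioms
    by (auto simp: algebra_isomorphic_def algebra_hom_def)
qed

section \<open>Centrally graded groups\<close>

context centrally_graded_group
begin

lemma grading_cancel [simp]: "g \<in> carrier G \<Longrightarrow> Z \<otimes> (Z \<otimes> g) = g"
  using grading_closed by (simp add: grading_square flip: m_assoc)

lemma degree_cases: "g \<in> carrier G \<Longrightarrow> d g = 0 \<or> d g = 1"
  using hom_in_carrier[OF degree_hom, of g] by (auto simp: carrier_integer_mod_group)

lemma degree_mult: "g \<in> carrier G \<Longrightarrow> h \<in> carrier G \<Longrightarrow> d (g \<otimes> h) = (d g + d h) mod 2"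
  using hom_mult[OF degree_hom] by simp

lemma grading_aut_eq:
  "g \<in> carrier G \<Longrightarrow> grading_aut G d Z g = (if d g = 0 then g else Z \<otimes> g)"
  using degree_cases[of g] grading_closed by (auto simp: grading_aut_def)

lemma grading_aut_closed: "g \<in> carrier G \<Longrightarrow> grading_aut G d Z g \<in> carrier G"
  using grading_closed by (simp add: grading_aut_eq)

text \<open>Since Z has degree 0, an odd element stays odd and is multiplied by Z twice.\<close>

lemma grading_aut_involution: "g \<in> carrier G \<Longrightarrow> grading_aut G d Z (grading_aut G d Z g) = g"
  using grading_closed degree_cases[of g]
  by (auto simp: grading_aut_eq degree_mult grading_degree)

text \<open>If both factors are odd, the two copies of Z cancel, in accordance with the even degree
  of the product.\<close>

lemma grading_aut_hom: "grading_aut G d Z \<in> hom G G"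
proof (rule homI)
  fix g h assume g: "g \<in> carrier G" and h: "h \<in> carrier G"
  have "g \<otimes> (Z \<otimes> h) = Z \<otimes> (g \<otimes> h)"
    using g h grading_closed by (metis grading_central m_assoc)
  then show "grading_aut G d Z (g \<otimes> h) = grading_aut G d Z g \<otimes> grading_aut G d Z h"
    using g h grading_closed degree_cases[of g] degree_cases[of h]
    by (auto simp: grading_aut_eq degree_mult m_assoc)
qed (rule grading_aut_closed)

text \<open>This is what makes \<open>\<alpha>_*\<close> preserve the eigenspaces of
  \<open>Z_*\<close>.\<close>

lemma grading_aut_grading_mult:
  "g \<in> carrier G \<Longrightarrow> grading_aut G d Z (Z \<otimes> g) = Z \<otimes> grading_aut G d Z g"
  using grading_closed degree_cases[of g] by (auto simp: grading_aut_eq degree_mult grading_degree)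

lemma grading_rcos_eq:
  assumes "g \<in> carrier G" "h \<in> carrier G"
  shows "{\<one>, Z} #> g = {\<one>, Z} #> h \<longleftrightarrow> h = g \<or> h = Z \<otimes> g"
proof -
  have "{\<one>, Z} #> x = {x, Z \<otimes> x}" if "x \<in> carrier G" for x
    using that by (auto simp: r_coset_def)
  then show ?thesis
    using assms grading_closed by (auto simp: doubleton_eq_iff)
qed

lemma grading_neq: "Z \<noteq> \<one> \<Longrightarrow> g \<in> carrier G \<Longrightarrow> Z \<otimes> g \<noteq> g"
  using grading_closed by (metis r_cancel_one)

end

locale centrally_graded_group_algebra =
  K: cring K + centrally_graded_group G d Z
  for K :: "('k, 'm) ring_scheme" and G :: "('g, 'n) monoid_scheme" (structure) and d Z +
  assumes two_unit: "\<one>\<^bsub>K\<^esub> \<oplus>\<^bsub>K\<^esub> \<one>\<^bsub>K\<^esub> \<in> Units K"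
    and grading_nontrivial: "Z \<noteq> \<one>"
begin

abbreviation "\<AA> \<equiv> group_algebra K G"
abbreviation "Q \<equiv> G Mod {\<one>, Z}"
abbreviation "\<pi> \<equiv> \<lambda>g. {\<one>, Z} #> g"
abbreviation "\<alpha> \<equiv> grading_aut G d Z"

sublocale A: assoc_algebra K \<AA>
  by (rule K.assoc_algebra_group_algebra) (rule is_monoid)

section \<open>The operator induced by Z and its eigenspaces\<close>

lemma Z_shift_hom: "module_hom K \<AA> \<AA> (pushforward K (\<lambda>g. Z \<otimes> g))"
proof -
  have "(\<lambda>g. Z \<otimes> g) \<in> carrier G \<rightarrow> carrier G"
    using grading_closed by auto
  from K.module_hom_pushforward[OF this] show ?thesis
    using A.module_axioms by (simp add: module_hom_def K.free_module_simps)
qed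

text \<open>Translation evaluates a function at the inverse translate; Z is its own inverse.\<close>

lemma Z_shift_apply:
  assumes f: "f \<in> carrier \<AA>" and g: "g \<in> carrier G"
  shows "pushforward K (\<lambda>g. Z \<otimes> g) f g = f (Z \<otimes> g)"
proof -
  have "inj_on (\<lambda>g. Z \<otimes> g) (carrier G)"
    using grading_closed by (auto simp: inj_on_def)
  from K.pushforward_inj[OF _ this, of f "Z \<otimes> g"] show ?thesis
    using f g grading_closed by simp
qed

lemma Z_shift_involution:
  "f \<in> carrier \<AA> \<Longrightarrow> pushforward K (\<lambda>g. Z \<otimes> g) (pushforward K (\<lambda>g. Z \<otimes> g) f) = f"
  by (simp add: K.pushforward_comp K.pushforward_id)

lemma Z_shift_eq_mult: "f \<in> carrier \<AA> \<Longrightarrow> pushforward K (\<lambda>g. Z \<otimes> g) f = delta K Z \<otimes>\<^bsub>\<AA>\<^esub> f"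
  by (simp add: K.delta_mult_left)

lemma delta_Z_closed: "delta K Z \<in> carrier \<AA>"
  using grading_closed by (simp add: K.delta_in_free_module)

lemma delta_Z_central: "f \<in> carrier \<AA> \<Longrightarrow> delta K Z \<otimes>\<^bsub>\<AA>\<^esub> f = f \<otimes>\<^bsub>\<AA>\<^esub> delta K Z"
  by (simp add: K.delta_mult_left K.delta_mult_right grading_central cong: K.pushforward_cong)

text \<open>One parameter treats both signs at once: the arguments below use at most that c lies in
  the ring and c*c = 1.\<close>

abbreviation "eigen c \<equiv> eigenspace \<AA> (pushforward K (\<lambda>g. Z \<otimes> g)) c"

lemma plus_part_eq: "plus_part K G Z = eigen \<one>\<^bsub>K\<^esub>"
  using A.smult_one by (auto simp: plus_part_def eigenspace_def simp del: K.group_algebra_simps)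

lemma minus_part_eq: "minus_part K G Z = eigen (\<ominus>\<^bsub>K\<^esub> \<one>\<^bsub>K\<^esub>)"
  using A.smult_l_minus[OF K.one_closed] A.smult_one
  by (auto simp: minus_part_def eigenspace_def simp del: K.group_algebra_simps)

lemma direct_sum: "internal_direct_sum K \<AA> (plus_part K G Z) (minus_part K G Z)"
  unfolding plus_part_eq minus_part_eq
  by (rule A.eigenspace_direct_sum[OF two_unit Z_shift_hom Z_shift_involution])

lemma submodule_eigen: "c \<in> carrier K \<Longrightarrow> submodule (eigen c) K \<AA>"
  by (rule A.submodule_eigenspace[OF Z_shift_hom])

lemma ideal_eigen:
  assumes c: "c \<in> carrier K"
  shows "ideal (eigen c) \<AA>"
proof -
  have eq: "eigen c = eigenspace \<AA> (\<lambda>f. delta K Z \<otimes>\<^bsub>\<AA>\<^esub> f) c"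
    by (auto simp: eigenspace_def Z_shift_eq_mult)
  show ?thesis
    unfolding eq
    by (rule A.ideal_eigenspace_central[OF delta_Z_closed c delta_Z_central])
       (use submodule_eigen[OF c] in \<open>simp_all add: eq\<close>)
qed

text \<open>For c = 1 and c = -1 these are the components of 1 in the two eigenspaces.\<close>

definition "eigen_unit c = inv\<^bsub>K\<^esub> (\<one>\<^bsub>K\<^esub> \<oplus>\<^bsub>K\<^esub> \<one>\<^bsub>K\<^esub>) \<odot>\<^bsub>\<AA>\<^esub> (\<one>\<^bsub>\<AA>\<^esub> \<oplus>\<^bsub>\<AA>\<^esub> c \<odot>\<^bsub>\<AA>\<^esub> delta K Z)"

text \<open>Writing z for \<open>delta K Z\<close>, the relation c*c = 1 gives z(1 + cz) = z + c =
  c(1 + cz), and on the eigenspace (1 + cz)f = f + c*c f = 2f.\<close>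

lemma eigen_unit:
  assumes c: "c \<in> carrier K" and cc: "c \<otimes>\<^bsub>K\<^esub> c = \<one>\<^bsub>K\<^esub>"
  shows "eigen_unit c \<in> eigen c"
    and "f \<in> eigen c \<Longrightarrow> eigen_unit c \<otimes>\<^bsub>\<AA>\<^esub> f = f \<and> f \<otimes>\<^bsub>\<AA>\<^esub> eigen_unit c = f"
proof -
  let ?h = "inv\<^bsub>K\<^esub> (\<one>\<^bsub>K\<^esub> \<oplus>\<^bsub>K\<^esub> \<one>\<^bsub>K\<^esub>)" and ?z = "delta K Z"
  note [simp del] = K.group_algebra_simps
  note z = delta_Z_closed
  have h: "?h \<in> carrier K"
    using two_unit by simp
  have u: "eigen_unit c \<in> carrier \<AA>"
    using h z c by (simp add: eigen_unit_def)
  have zz: "?z \<otimes>\<^bsub>\<AA>\<^esub> ?z = \<one>\<^bsub>\<AA>\<^esub>"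
    by (simp add: delta_mult[OF K.is_cring] grading_square K.group_algebra_simps)
  have "?z \<otimes>\<^bsub>\<AA>\<^esub> eigen_unit c = c \<odot>\<^bsub>\<AA>\<^esub> eigen_unit c"
  proof -
    have "c \<odot>\<^bsub>\<AA>\<^esub> eigen_unit c = ?h \<odot>\<^bsub>\<AA>\<^esub> (c \<odot>\<^bsub>\<AA>\<^esub> (\<one>\<^bsub>\<AA>\<^esub> \<oplus>\<^bsub>\<AA>\<^esub> c \<odot>\<^bsub>\<AA>\<^esub> ?z))"
      unfolding eigen_unit_def using h z c
      by (simp add: K.m_comm flip: A.smult_assoc1)
    also have "c \<odot>\<^bsub>\<AA>\<^esub> (\<one>\<^bsub>\<AA>\<^esub> \<oplus>\<^bsub>\<AA>\<^esub> c \<odot>\<^bsub>\<AA>\<^esub> ?z) = ?z \<otimes>\<^bsub>\<AA>\<^esub> (\<one>\<^bsub>\<AA>\<^esub> \<oplus>\<^bsub>\<AA>\<^esub> c \<odot>\<^bsub>\<AA>\<^esub> ?z)"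
      using z c by (simp add: A.smult_r_distr A.r_distr A.smult_mult_right zz cc A.a_comm
          flip: A.smult_assoc1)
    finally show ?thesis
      using z h c by (simp add: eigen_unit_def A.smult_mult_right)
  qed
  then show "eigen_unit c \<in> eigen c"
    using u by (simp add: eigenspace_def Z_shift_eq_mult)
  assume "f \<in> eigen c"
  then have f: "f \<in> carrier \<AA>" and zf: "?z \<otimes>\<^bsub>\<AA>\<^esub> f = c \<odot>\<^bsub>\<AA>\<^esub> f"
    by (auto simp: eigenspace_def Z_shift_eq_mult)
  have uf: "eigen_unit c \<otimes>\<^bsub>\<AA>\<^esub> f = ?h \<odot>\<^bsub>\<AA>\<^esub> (f \<oplus>\<^bsub>\<AA>\<^esub> f)"
    using f z h c by (simp add: eigen_unit_def A.smult_mult_left A.l_distr zf cc flip: A.smult_assoc1)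
  have fu: "f \<otimes>\<^bsub>\<AA>\<^esub> eigen_unit c = ?h \<odot>\<^bsub>\<AA>\<^esub> (f \<oplus>\<^bsub>\<AA>\<^esub> f)"
    using f z h c by (simp add: eigen_unit_def A.smult_mult_right A.r_distr zf cc
        flip: A.smult_assoc1 delta_Z_central)
  show "eigen_unit c \<otimes>\<^bsub>\<AA>\<^esub> f = f \<and> f \<otimes>\<^bsub>\<AA>\<^esub> eigen_unit c = f"
    unfolding uf fu A.smult_half_double[OF two_unit f] by simp
qed

lemma minus_one_square [simp]: "\<ominus>\<^bsub>K\<^esub> \<one>\<^bsub>K\<^esub> \<otimes>\<^bsub>K\<^esub> \<ominus>\<^bsub>K\<^esub> \<one>\<^bsub>K\<^esub> = \<one>\<^bsub>K\<^esub>"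
  by (simp add: K.l_minus K.r_minus K.minus_minus)

section \<open>The involution induced by \<alpha> and the super-algebra structures\<close>

lemma alpha_hom: "algebra_hom K \<AA> \<AA> (pushforward K \<alpha>)"
  using degree_hom grading_closed hom_one[OF degree_hom]
  by (intro K.algebra_hom_pushforward is_monoid grading_aut_hom) (simp add: grading_aut_eq)

lemma alpha_involution: "f \<in> carrier \<AA> \<Longrightarrow> pushforward K \<alpha> (pushforward K \<alpha> f) = f"
  by (simp add: K.pushforward_comp K.pushforward_id grading_aut_involution)

lemma alpha_eigen:
  assumes c: "c \<in> carrier K" and "f \<in> eigen c"
  shows "pushforward K \<alpha> f \<in> eigen c"
proof -
  have f: "f \<in> carrier \<AA>" and Zf: "pushforward K (\<lambda>g. Z \<otimes> g) f = c \<odot>\<^bsub>\<AA>\<^esub> f"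
    using assms by (auto simp: eigenspace_def)
  have hom: "module_hom K \<AA> \<AA> (pushforward K \<alpha>)"
    using alpha_hom by (simp add: algebra_hom_def)
  have "pushforward K (\<lambda>g. Z \<otimes> g) (pushforward K \<alpha> f) = pushforward K \<alpha> (pushforward K (\<lambda>g. Z \<otimes> g) f)"
    using f by (simp add: K.pushforward_comp grading_aut_grading_mult cong: K.pushforward_cong)
  also have "\<dots> = c \<odot>\<^bsub>\<AA>\<^esub> pushforward K \<alpha> f"
    unfolding Zf using module_homD(3)[OF hom c f] .
  finally show ?thesis
    using module_homD(1)[OF hom f] by (simp add: eigenspace_def)
qed

lemma super_algebra: "super_algebra_wrt K \<AA> (pushforward K \<alpha>)"
  using alpha_hom
  by (intro A.super_algebra_wrt_involution[OF two_unit])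
     (auto simp: algebra_hom_def ring_hom_mult alpha_involution simp del: K.group_algebra_simps)

lemma super_algebra_eigen:
  assumes "c \<in> carrier K" and "c \<otimes>\<^bsub>K\<^esub> c = \<one>\<^bsub>K\<^esub>"
  shows "super_algebra_wrt K (ideal_algebra \<AA> (eigen c)) (pushforward K \<alpha>)"
  using A.super_algebra_wrt_ideal_algebra[OF two_unit alpha_hom alpha_involution
      submodule_eigen[OF assms(1)] ideal_eigen[OF assms(1)] eigen_unit[OF assms] alpha_eigen[OF assms(1)]] .

section \<open>The projection to the quotient by Z\<close>

lemma quotient_group: "group Q"
  by (rule normal.factorgroup_is_group[OF grading_normal])

lemma pi_hom: "algebra_hom K \<AA> (group_algebra K Q) (pushforward K \<pi>)"
proof (rule K.algebra_hom_pushforward)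
  show "monoid Q"
    using quotient_group by (simp add: group_def)
  show "\<pi> \<in> hom G Q"
    by (rule normal.r_coset_hom_Mod[OF grading_normal])
  show "\<pi> \<one> = \<one>\<^bsub>Q\<^esub>"
    using grading_closed by (simp add: FactGroup_def)
qed (rule is_monoid)

lemma pi_surj: "pushforward K \<pi> ` carrier \<AA> = carrier (group_algebra K Q)"
proof
  show "pushforward K \<pi> ` carrier \<AA> \<subseteq> carrier (group_algebra K Q)"
    using pi_hom by (auto simp: algebra_hom_def module_hom_def simp del: K.group_algebra_simps)
next
  \<comment> \<open>A choice of coset representatives; \<sigma> need not be multiplicative, as only
    \<pi> \<sigma> = id on the quotient matters.\<close>
  define \<sigma> where "\<sigma> = inv_into (carrier G) \<pi>"
  have \<sigma>: "\<sigma> q \<in> carrier G" "\<pi> (\<sigma> q) = q" if "q \<in> carrier Q" for q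
  proof -
    have "q \<in> \<pi> ` carrier G"
      using that by (auto simp: FactGroup_def RCOSETS_def)
    then show "\<sigma> q \<in> carrier G" "\<pi> (\<sigma> q) = q"
      by (auto simp: \<sigma>_def inv_into_into f_inv_into_f)
  qed
  have "f \<in> pushforward K \<pi> ` carrier \<AA>" if f: "f \<in> carrier (group_algebra K Q)" for f
  proof (rule image_eqI)
    show "pushforward K \<sigma> f \<in> carrier \<AA>"
      using f \<sigma>(1) by (auto intro: K.pushforward_closed)
    show "f = pushforward K \<pi> (pushforward K \<sigma> f)"
      using f \<sigma>(2) by (simp add: K.pushforward_comp K.pushforward_id)
  qed
  then show "carrier (group_algebra K Q) \<subseteq> pushforward K \<pi> ` carrier \<AA>"
    by blast
qed

lemma pi_apply:
  assumes f: "f \<in> carrier \<AA>" and g: "g \<in> carrier G"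
  shows "pushforward K \<pi> f (\<pi> g) = f g \<oplus>\<^bsub>K\<^esub> f (Z \<otimes> g)"
proof -
  \<comment> \<open>Either of \<open>f g\<close> and \<open>f (Z \<otimes> g)\<close> may vanish, so
    both points of the coset are adjoined to the support.\<close>
  let ?S = "supp K f \<union> {g, Z \<otimes> g}"
  have f': "f \<in> carrier (free_module K (carrier G))"
    using f by simp
  have S: "finite ?S" "?S \<subseteq> carrier G"
    using f' g grading_closed by (auto simp: K.free_module_iff)
  have "\<pi> x = \<pi> g \<longleftrightarrow> x = g \<or> x = Z \<otimes> g" if "x \<in> ?S" for x
    using grading_rcos_eq[OF g, of x] S(2) that by (metis subsetD)
  then have "{x \<in> ?S. \<pi> x = \<pi> g} = {x \<in> ?S. x = g \<or> x = Z \<otimes> g}"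
    by (intro Collect_cong conj_cong refl)
  then have "{x \<in> ?S. \<pi> x = \<pi> g} = {g, Z \<otimes> g}"
    by auto
  then have "pushforward K \<pi> f (\<pi> g) = (\<Oplus>\<^bsub>K\<^esub>x\<in>{g, Z \<otimes> g}. f x)"
    using K.pushforward_eq[OF f' S(1) Un_upper1, of \<pi> "\<pi> g"] by simp
  then show ?thesis
    \<comment> \<open>The two points are distinct as Z is non-trivial; otherwise the sum over the
      set would have a single term.\<close>
    using f' g grading_neq[OF grading_nontrivial g] by simp
qed

lemma minus_part_iff:
  "f \<in> minus_part K G Z \<longleftrightarrow>
    f \<in> carrier \<AA> \<and> (\<forall>g\<in>carrier G. f (Z \<otimes> g) = \<ominus>\<^bsub>K\<^esub> f g)"
proof (cases "f \<in> carrier \<AA>")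
  case True
  then have f: "f \<in> carrier (free_module K (carrier G))"
    by simp
  have Zf: "pushforward K (\<lambda>g. Z \<otimes> g) f \<in> carrier (free_module K (carrier G))"
    using f grading_closed by (auto intro: K.pushforward_closed)
  have "pushforward K (\<lambda>g. Z \<otimes> g) f = (\<lambda>g. \<ominus>\<^bsub>K\<^esub> f g) \<longleftrightarrow>
      (\<forall>g\<in>carrier G. f (Z \<otimes> g) = \<ominus>\<^bsub>K\<^esub> f g)" (is "?l \<longleftrightarrow> ?r")
  proof
    assume ?l
    then show ?r
      using Z_shift_apply[OF True] by metis
  next
    assume r: ?r
    show ?l
    proof
      fix g
      show "pushforward K (\<lambda>g. Z \<otimes> g) f g = \<ominus>\<^bsub>K\<^esub> f g"
        using r Z_shift_apply[OF True] K.free_module_outside[OF Zf] K.free_module_outside[OF f]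
        by (cases "g \<in> carrier G") auto
    qed
  qed
  with True f show ?thesis
    by (simp add: minus_part_eq eigenspace_def K.l_minus)
qed (auto simp: minus_part_def)

lemma kernel_pi: "a_kernel \<AA> (group_algebra K Q) (pushforward K \<pi>) = minus_part K G Z"
proof -
  have "pushforward K \<pi> f = (\<lambda>q. \<zero>\<^bsub>K\<^esub>) \<longleftrightarrow> (\<forall>g\<in>carrier G. f (Z \<otimes> g) = \<ominus>\<^bsub>K\<^esub> f g)"
    (is "?l \<longleftrightarrow> ?r") if f: "f \<in> carrier \<AA>" for f
  proof
    assume l: ?l
    show ?r
    proof
      fix g assume g: "g \<in> carrier G"
      then have "f g \<oplus>\<^bsub>K\<^esub> f (Z \<otimes> g) = \<zero>\<^bsub>K\<^esub>"
        using pi_apply[OF f g] l by simp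
      then show "f (Z \<otimes> g) = \<ominus>\<^bsub>K\<^esub> f g"
        using f K.add.inv_equality[of "f (Z \<otimes> g)" "f g"] by (simp add: K.a_comm)
    qed
  next
    assume r: ?r
    \<comment> \<open>The argument \<open>q\<close> below ranges over all sets of the type; this
      settles those that are not cosets.\<close>
    have \<pi>f: "pushforward K \<pi> f \<in> carrier (free_module K (carrier Q))"
      using pi_surj f by auto
    show ?l
    proof
      fix q
      show "pushforward K \<pi> f q = \<zero>\<^bsub>K\<^esub>"
      proof (cases "q \<in> carrier Q")
        case True
        then obtain g where "g \<in> carrier G" "q = \<pi> g"
          by (auto simp: FactGroup_def RCOSETS_def)
        with r f show ?thesis
          by (simp add: pi_apply K.r_neg)
      qed (rule K.free_module_outside[OF \<pi>f])
    qed
  qed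
  then show ?thesis
    by (auto simp: a_kernel_def' minus_part_iff simp del: K.group_algebra_simps(1))
qed

lemma plus_part_isomorphic: "algebra_isomorphic K (ideal_algebra \<AA> (plus_part K G Z)) (group_algebra K Q)"
  using direct_sum ideal_eigen[of "\<one>\<^bsub>K\<^esub>"] eigen_unit[of "\<one>\<^bsub>K\<^esub>"]
  by (intro ideal_algebra_isomorphic[OF pi_hom pi_surj, where u = "eigen_unit \<one>\<^bsub>K\<^esub>"])
     (auto simp: kernel_pi plus_part_eq)

section \<open>Comparison of the plus and minus parts as modules\<close>

lemma plus_part_iff:
  "f \<in> plus_part K G Z \<longleftrightarrow> f \<in> carrier \<AA> \<and> (\<forall>g\<in>carrier G. f (Z \<otimes> g) = f g)"
proof (cases "f \<in> carrier \<AA>")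
  case True
  then have f: "f \<in> carrier (free_module K (carrier G))"
    by simp
  have Zf: "pushforward K (\<lambda>g. Z \<otimes> g) f \<in> carrier (free_module K (carrier G))"
    using f grading_closed by (auto intro: K.pushforward_closed)
  have "pushforward K (\<lambda>g. Z \<otimes> g) f = f" if r: "\<forall>g\<in>carrier G. f (Z \<otimes> g) = f g"
  proof
    fix g
    show "pushforward K (\<lambda>g. Z \<otimes> g) f g = f g"
      using r Z_shift_apply[OF True] K.free_module_outside[OF Zf] K.free_module_outside[OF f]
      by (cases "g \<in> carrier G") auto
  qed
  with True show ?thesis
    using Z_shift_apply[OF True] by (auto simp: plus_part_def)
qed (auto simp: plus_part_def)

text \<open>Multiplication by a sign function \<open>s\<close> with \<open>s(Zg) = -s(g)\<close> exchanges the two parts; such a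
  function exists because \<open>Z\<close> acts on \<open>G\<close> without fixed points.\<close>

lemma ex_sign:
  obtains s where "\<And>g. s g \<in> carrier K" "\<And>g. s g \<otimes>\<^bsub>K\<^esub> s g = \<one>\<^bsub>K\<^esub>"
    "\<And>g. g \<in> carrier G \<Longrightarrow> s (Z \<otimes> g) = \<ominus>\<^bsub>K\<^esub> s g"
proof -
  define \<sigma> where "\<sigma> = inv_into (carrier G) \<pi>"
  \<comment> \<open>Exactly one of g and Zg is the chosen representative of their coset, so s takes
    opposite signs on them.\<close>
  define s where "s g = (if \<sigma> (\<pi> g) = g then \<one>\<^bsub>K\<^esub> else \<ominus>\<^bsub>K\<^esub> \<one>\<^bsub>K\<^esub>)" for g
  have "s (Z \<otimes> g) = \<ominus>\<^bsub>K\<^esub> s g" if g: "g \<in> carrier G" for g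
  proof -
    have Zg: "Z \<otimes> g \<in> carrier G"
      using g grading_closed by simp
    have "\<pi> (Z \<otimes> g) = \<pi> g"
      using grading_rcos_eq[OF g Zg] by simp
    moreover have "\<sigma> (\<pi> g) \<in> carrier G" "\<pi> (\<sigma> (\<pi> g)) = \<pi> g"
      using g by (auto simp: \<sigma>_def inv_into_into f_inv_into_f)
    then have "\<sigma> (\<pi> g) = g \<or> \<sigma> (\<pi> g) = Z \<otimes> g"
      using grading_rcos_eq[OF g, of "\<sigma> (\<pi> g)"] by simp
    ultimately show ?thesis
      using grading_neq[OF grading_nontrivial g] by (auto simp: s_def K.minus_minus)
  qed
  moreover have "s g \<in> carrier K" "s g \<otimes>\<^bsub>K\<^esub> s g = \<one>\<^bsub>K\<^esub>" for g
    by (auto simp: s_def)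
  ultimately show ?thesis
    using that by blast
qed

text \<open>As s*s = 1, multiplication by s is its own inverse and serves in both directions. The
  arbitrary choice behind s leaves no control over products, hence an isomorphism of
  modules.\<close>

lemma plus_minus_isomorphic:
  "module_isomorphic K (\<AA>\<lparr>carrier := plus_part K G Z\<rparr>) (\<AA>\<lparr>carrier := minus_part K G Z\<rparr>)"
proof -
  obtain s where s: "\<And>g. s g \<in> carrier K" and ss: "\<And>g. s g \<otimes>\<^bsub>K\<^esub> s g = \<one>\<^bsub>K\<^esub>"
    and sZ: "\<And>g. g \<in> carrier G \<Longrightarrow> s (Z \<otimes> g) = \<ominus>\<^bsub>K\<^esub> s g"
    using ex_sign by metis
  let ?h = "\<lambda>f g. s g \<otimes>\<^bsub>K\<^esub> f g"
  have pm: "?h f \<in> minus_part K G Z" if "f \<in> plus_part K G Z" for f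
    using that s by (auto simp: plus_part_iff minus_part_iff sZ K.free_module_mult K.l_minus)
  have mp: "?h f \<in> plus_part K G Z" if "f \<in> minus_part K G Z" for f
    using that s by (auto simp: plus_part_iff minus_part_iff sZ K.free_module_mult K.l_minus K.r_minus
        K.minus_minus)
  have hh: "?h (?h f) = f" if "f \<in> carrier \<AA>" for f
    using that s by (auto simp: ss simp flip: K.m_assoc)
  have "bij_betw ?h (plus_part K G Z) (minus_part K G Z)"
    by (rule bij_betw_byWitness[where f' = ?h])
       (use pm mp hh in \<open>auto simp: plus_part_iff minus_part_iff\<close>)
  moreover have "module_hom K (\<AA>\<lparr>carrier := plus_part K G Z\<rparr>) (\<AA>\<lparr>carrier := minus_part K G Z\<rparr>) ?h"
    unfolding module_hom_def
  proof (intro conjI ballI)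
    show "module K (\<AA>\<lparr>carrier := plus_part K G Z\<rparr>)" "module K (\<AA>\<lparr>carrier := minus_part K G Z\<rparr>)"
      using direct_sum by (auto simp: internal_direct_sum_def intro: submodule.submodule_is_module)
  qed (use pm s in \<open>auto simp: plus_part_iff K.r_distr K.m_lcomm\<close>)
  ultimately show ?thesis
    by (auto simp: module_isomorphic_def)
qed

section \<open>Decomposition by degree\<close>

lemma degree_parts: "carrier G = degree_part G d 0 \<union> degree_part G d 1"
    "degree_part G d 0 \<inter> degree_part G d 1 = {}"
  using degree_cases by (auto simp: degree_part_def)

lemma submodule_free_module:
  assumes "M \<subseteq> carrier G"
  shows "submodule (carrier (free_module K M)) K \<AA>"
proof (rule A.module_incl_imp_submodule)
  show "carrier (free_module K M) \<subseteq> carrier \<AA>"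
    using K.free_module_mono[OF assms] by simp
  show "module K (\<AA>\<lparr>carrier := carrier (free_module K M)\<rparr>)"
    using K.module_free_module[of M]
    by (simp add: group_algebra_def module_def abelian_group_def module_axioms_def
        abelian_monoid_def abelian_group_axioms_def free_module_def)
qed

lemma degree_direct_sum:
  "internal_direct_sum K \<AA> (carrier (free_module K (degree_part G d 0)))
    (carrier (free_module K (degree_part G d 1)))" (is "internal_direct_sum K \<AA> ?U ?V")
proof -
  have sub: "submodule ?U K \<AA>" "submodule ?V K \<AA>"
    by (auto intro!: submodule_free_module simp: degree_part_def)
  have "f \<in> ?U <+>\<^bsub>\<AA>\<^esub> ?V" if f: "f \<in> carrier \<AA>" for f
  proof -
    \<comment> \<open>Cut-offs of f by degree. Outside the group d is unconstrained, but f vanishes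
      there.\<close>
    let ?r = "\<lambda>k g. if d g = k then f g else \<zero>\<^bsub>K\<^esub>"
    have f': "f \<in> carrier (free_module K (carrier G))"
      using f by simp
    have "?r 0 \<in> ?U" "?r 1 \<in> ?V"
      using f' by (auto simp: K.free_module_iff supp_def degree_part_def elim!: rev_finite_subset)
    moreover have "f g = ?r 0 g \<oplus>\<^bsub>K\<^esub> ?r 1 g" for g
      using f' degree_cases[of g] K.free_module_outside[OF f', of g]
      by (cases "g \<in> carrier G") auto
    then have "f = ?r 0 \<oplus>\<^bsub>\<AA>\<^esub> ?r 1"
      by auto
    ultimately show ?thesis
      unfolding set_add_def' by (intro UN_I[of "?r 0"] UN_I[of "?r 1"]) simp_all
  qed
  moreover have "?U <+>\<^bsub>\<AA>\<^esub> ?V \<subseteq> carrier \<AA>"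
    using A.submoduleE(1)[OF sub(1)] A.submoduleE(1)[OF sub(2)]
    by (rule A.set_add_closed)
  ultimately have sum: "?U <+>\<^bsub>\<AA>\<^esub> ?V = carrier \<AA>"
    by (auto simp del: K.group_algebra_simps)
  have zero: "f = \<zero>\<^bsub>\<AA>\<^esub>" if "f \<in> ?U \<inter> ?V" for f
    unfolding K.group_algebra_simps
  proof
    fix g
    show "f g = \<zero>\<^bsub>K\<^esub>"
      using that K.free_module_outside[of f "degree_part G d 0" g]
        K.free_module_outside[of f "degree_part G d 1" g] degree_parts(2)
      by (cases "g \<in> degree_part G d 0") auto
  qed
  have "\<zero>\<^bsub>\<AA>\<^esub> \<in> ?U \<inter> ?V"
    by (auto simp: K.free_module_iff supp_def)
  then have "?U \<inter> ?V = {\<zero>\<^bsub>\<AA>\<^esub>}"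
    by (intro equalityI subsetI singletonI) (simp_all only: singleton_iff zero)
  with sum sub A.module_axioms show ?thesis
    by (simp only: internal_direct_sum_def)
qed

lemma even_degree_subset: "carrier (free_module K (degree_part G d 0)) \<subseteq> alpha_part K G d Z 0"
proof
  fix f assume f: "f \<in> carrier (free_module K (degree_part G d 0))"
  have "degree_part G d 0 \<subseteq> carrier G"
    by (auto simp: degree_part_def)
  from K.free_module_mono[OF this] have "f \<in> carrier (free_module K (carrier G))"
    using f by auto
  moreover have "pushforward K \<alpha> f = f"
    by (rule K.pushforward_id[OF f]) (auto simp: degree_part_def grading_aut_eq)
  ultimately show "f \<in> alpha_part K G d Z 0"
    by (simp add: alpha_part_def eigenspace_def)
qed

text \<open>At an even g, which \<alpha> fixes, the eigenvalue equation reads f(g) = -f(g).\<close>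

lemma odd_degree_superset: "alpha_part K G d Z 1 \<subseteq> carrier (free_module K (degree_part G d 1))"
proof
  fix f assume "f \<in> alpha_part K G d Z 1"
  then have f: "f \<in> carrier (free_module K (carrier G))"
    and \<alpha>f: "pushforward K \<alpha> f = (\<lambda>g. \<ominus>\<^bsub>K\<^esub> f g)"
    by (auto simp: alpha_part_def eigenspace_def K.l_minus)
  have "f g = \<zero>\<^bsub>K\<^esub>" if g: "g \<in> degree_part G d 0" for g
  proof -
    have "g \<in> carrier G" "\<alpha> g = g"
      using g by (auto simp: degree_part_def grading_aut_eq)
    moreover have "inj_on \<alpha> (carrier G)"
      by (rule inj_on_inverseI[where g = \<alpha>]) (rule grading_aut_involution)
    ultimately have "f g = \<ominus>\<^bsub>K\<^esub> f g"
      using K.pushforward_inj[OF f, of \<alpha> g] \<alpha>f by simp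
    then have "f g \<oplus>\<^bsub>K\<^esub> f g = \<zero>\<^bsub>K\<^esub>"
      using f K.r_neg[of "f g"] by simp
    then have "(\<one>\<^bsub>K\<^esub> \<oplus>\<^bsub>K\<^esub> \<one>\<^bsub>K\<^esub>) \<otimes>\<^bsub>K\<^esub> f g = \<zero>\<^bsub>K\<^esub>"
      using f by (simp add: K.l_distr)
    then show ?thesis
      using f two_unit by (metis K.Units_closed K.Units_l_cancel K.free_module_closed K.r_null K.zero_closed)
  qed
  then have "supp K f \<subseteq> degree_part G d 1"
    using f degree_parts(1) by (auto simp: supp_def K.free_module_iff)
  with f show "f \<in> carrier (free_module K (degree_part G d 1))"
    by (auto simp: K.free_module_iff)
qed

end

theorem theorem4p1:
  fixes K :: "('k, 'm) ring_scheme" and G :: "('g, 'n) monoid_scheme"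
    and d :: "'g \<Rightarrow> int" and Z :: 'g
  assumes "cring K"
    and "\<one>\<^bsub>K\<^esub> \<oplus>\<^bsub>K\<^esub> \<one>\<^bsub>K\<^esub> \<in> Units K"
    and "centrally_graded_group G d Z"
    and "Z \<noteq> \<one>\<^bsub>G\<^esub>"
  defines "A \<equiv> group_algebra K G"
    and "Aplus \<equiv> plus_part K G Z"
    and "Aminus \<equiv> minus_part K G Z"
    and "A\<^sub>0 \<equiv> alpha_part K G d Z 0"
    and "A\<^sub>1 \<equiv> alpha_part K G d Z 1"
    and "G\<^sub>0 \<equiv> degree_part G d 0"
    and "G\<^sub>1 \<equiv> degree_part G d 1"
    and "Q \<equiv> G Mod {\<one>\<^bsub>G\<^esub>, Z}"
    and "\<pi> \<equiv> (\<lambda>g. {\<one>\<^bsub>G\<^esub>, Z} #>\<^bsub>G\<^esub> g)"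
    and "\<alpha> \<equiv> grading_aut G d Z"
  shows
    "(ideal Aplus A \<and> ideal Aminus A \<and> internal_direct_sum K A Aplus Aminus \<and>
      module_isomorphic K (A\<lparr>carrier := Aplus\<rparr>) (A\<lparr>carrier := Aminus\<rparr>) \<and>
      algebra_hom K A (group_algebra K Q) (pushforward K \<pi>) \<and>
      a_kernel A (group_algebra K Q) (pushforward K \<pi>) = Aminus \<and>
      algebra_isomorphic K
        ((group_algebra K Q)\<lparr>carrier := pushforward K \<pi> ` carrier A\<rparr>) (ideal_algebra A Aplus) \<and>
      algebra_isomorphic K (ideal_algebra A Aplus) (group_algebra K Q)) \<and>
     (super_algebra_wrt K A (pushforward K \<alpha>) \<and>
      super_algebra_wrt K (ideal_algebra A Aplus) (pushforward K \<alpha>) \<and>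
      super_algebra_wrt K (ideal_algebra A Aminus) (pushforward K \<alpha>) \<and>
      carrier G = G\<^sub>0 \<union> G\<^sub>1 \<and> G\<^sub>0 \<inter> G\<^sub>1 = {} \<and>
      internal_direct_sum K A (carrier (free_module K G\<^sub>0)) (carrier (free_module K G\<^sub>1)) \<and>
      carrier (free_module K G\<^sub>0) \<subseteq> A\<^sub>0 \<and> A\<^sub>1 \<subseteq> carrier (free_module K G\<^sub>1))"
proof -
  interpret centrally_graded_group_algebra K G d Z
    using assms(1-4) by (simp add: centrally_graded_group_algebra_def centrally_graded_group_algebra_axioms_def)
  \<comment> \<open>By surjectivity the image is the whole quotient algebra, including its unit, so
    replacing the carrier changes nothing.\<close>
  have image: "(group_algebra K Q)\<lparr>carrier := pushforward K \<pi> ` carrier A\<rparr> = group_algebra K Q"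
    unfolding A_def \<pi>_def Q_def pi_surj by simp
  show ?thesis
    unfolding image
    unfolding A_def Aplus_def Aminus_def A\<^sub>0_def A\<^sub>1_def G\<^sub>0_def G\<^sub>1_def Q_def \<pi>_def \<alpha>_def
    using ideal_eigen[of "\<one>\<^bsub>K\<^esub>"] ideal_eigen[of "\<ominus>\<^bsub>K\<^esub> \<one>\<^bsub>K\<^esub>"]
      super_algebra_eigen[of "\<one>\<^bsub>K\<^esub>"] super_algebra_eigen[of "\<ominus>\<^bsub>K\<^esub> \<one>\<^bsub>K\<^esub>"]
    by (intro conjI direct_sum plus_minus_isomorphic pi_hom kernel_pi plus_part_isomorphic
        algebra_isomorphic_sym[OF plus_part_isomorphic] super_algebra degree_parts degree_direct_sum
        even_degree_subset odd_degree_superset)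
      (simp_all add: plus_part_eq minus_part_eq)
qed

end
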